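(* Let $m$ be a fixed positive integer and define the arithmetic function $f_m$ by the Dirichlet series identity $$\sum_{k=1}^{\infty}\frac{f_m(k)}{k^s} = 2\,\frac{\zeta(2m)^2\,\zeta(s+4m-1)}{\zeta(4m)\,\zeta(s+2m)^2}\,\zeta(s).$$ Then, as the positive integer $k\to\infty$, $$\sum_{\substack{h=1\\ (h,k)=1}}^{k} s(h,k)^{2m} = f_m(k)\left(\frac{k}{12}\right)^{2m} + O\!\left(\left(k^{9/5}+k^{2m-1+\frac{1}{m+1}}\right)\log^3 k\right).$$
   Context: For a positive integer $k$ and an integer $h$, the Dedekind sum is $s(h,k)=\sum_{a=1}^{k}\left(\left(\frac{a}{k}\right)\right)\left(\left(\frac{ah}{k}\right)\right)$, where $((x)) = x-\lfloor x\rfloor-\tfrac12$ if $x\notin\mathbb{Z}$ and $((x))=0$ if $x\in\mathbb{Z}$. $\zeta$ denotes the Riemann zeta function. The implied constant in the $O$-term may depend on $m$. *)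

theory Defs
  imports "HOL-Analysis.Analysis" "HOL-Library.Landau_Symbols"
begin

definition sawtooth :: "real \<Rightarrow> real" where
  "sawtooth x = (if x \<in> \<int> then 0 else x - of_int \<lfloor>x\<rfloor> - 1 / 2)"

definition dedekind_sum :: "int \<Rightarrow> nat \<Rightarrow> real" where
  "dedekind_sum h k =
     (\<Sum>a=1..k. sawtooth (real a / real k) * sawtooth (real a * of_int h / real k))"

text \<open>
  The Dirichlet series of the Riemann zeta function. It agrees with the zeta function only on
  the half-plane \<open>Re s > 1\<close>; no other arguments are used below.
\<close>
definition zeta :: "complex \<Rightarrow> complex" where
  "zeta s = (\<Sum>n. 1 / of_nat (Suc n) powr s)"

end

theory Submission
  imports Defs
begin

text \<open>
  The Dedekind sum \<open>s(h, k)\<close> is large only if \<open>h / k\<close> is close to a fraction \<open>c / d\<close> with small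
  denominator: writing \<open>r = h d - k c\<close>, the reciprocity law gives
  \<open>s(h, k) = k / (12 d r) + O(d |r|)\<close>. Each \<open>h\<close> has at most one such fraction with
  \<open>2 (d |r|)\<^sup>2 < k\<close>. If there is none, Euclid's algorithm bounds \<open>s(h, k)\<close> by
  \<open>O(log k) k / n\<close>, where \<open>n\<close> is the minimum of \<open>d |r|\<close>. So up to an admissible error the moment
  is the sum of \<open>(k / (12 d r))\<close> to the power \<open>2 m\<close> over all triples \<open>(h, d, r)\<close>. Removing
  the coprimality conditions on \<open>(h, k)\<close> and \<open>(c, d)\<close> turns this sum into Dirichlet convolutions with
  \<open>u \<mapsto> u\<close> to the power \<open>- 2 m\<close>, and these identify it with \<open>f k\<close> by uniqueness of Dirichlet
  coefficients. All error terms are bounded by the same sum over triples with exponent \<open>3 / 2\<close> in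
  place of \<open>2 m\<close>, which is at most \<open>2 \<zeta>(3/2)\<^sup>2\<close> for every \<open>k\<close>.
\<close>

section \<open>The reciprocity law\<close>

text \<open>The obstacle is the summation over \<open>h\<close>: there are up to \<open>k\<close>
  residues, and an error bound uniform in \<open>h\<close> would lose a factor \<open>k\<close>.
  Every error is therefore kept proportional to a negative power of the pair size
  \<open>n = d |r|\<close>, whose sum over all triples stays bounded as \<open>k\<close> grows.
  Replacing \<open>s(h, k)\<close> by \<open>k / (12 d r)\<close> in the power \<open>2 m\<close>
  costs about \<open>k^(2 m - 1) n^(2 - 2 m)\<close>, which for \<open>m = 1\<close> has no decay in
  \<open>n\<close> at all. The condition \<open>2 n^2 < k\<close> supplies it: a factor
  \<open>n^w\<close> is traded for \<open>k^(w / 2)\<close>, leaving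
  \<open>k^(1 + w / 2) n^(-w)\<close>. Convergence asks for \<open>w > 1\<close> and the exponent
  \<open>9 / 5\<close> for \<open>w\<close> at most \<open>8 / 5\<close>; the choice
  \<open>w = 3 / 2\<close> lies between and serves every \<open>m\<close>. Pairs with
  \<open>2 n^2\<close> at least \<open>k\<close> then cost \<open>k^(m + 3 / 4)\<close>, which is
  smaller by a power of \<open>k\<close> than the admissible error. That power absorbs the
  \<open>2 m\<close> logarithms coming from Euclid's algorithm, although only three are
  allowed.\<close>

lemma sawtooth_add_of_int: "sawtooth (x + of_int n) = sawtooth x"
  by (auto simp: sawtooth_def)

lemma sawtooth_minus: "sawtooth (- x) = - sawtooth x"
proof (cases "x \<in> \<int>")
  case False
  then have "\<lfloor>- x\<rfloor> = - \<lfloor>x\<rfloor> - 1"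
    by (metis Ints_of_int ceiling_altdef ceiling_def minus_minus add_diff_cancel minus_add_distrib uminus_add_conv_diff diff_minus_eq_add)
  with False show ?thesis by (simp add: sawtooth_def)
qed (simp add: sawtooth_def)

lemma abs_sawtooth_le: "\<bar>sawtooth x\<bar> \<le> 1 / 2"
proof -
  have "\<bar>x - of_int \<lfloor>x\<rfloor> - 1 / 2\<bar> \<le> 1 / 2" by linarith
  then show ?thesis by (simp add: sawtooth_def)
qed

lemma sawtooth_of_int_div:
  assumes "k > 0"
  shows "sawtooth (of_int a / real k) =
    (if int k dvd a then 0 else of_int (a mod int k) / real k - 1 / 2)"
proof -
  have "real_of_int a / real k \<in> \<int> \<longleftrightarrow> int k dvd a"
  proof
    assume "real_of_int a / real k \<in> \<int>"
    then obtain n where "real_of_int a / real k = of_int n" by (auto elim: Ints_cases)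
    then have "real_of_int a = of_int (n * int k)" using assms by (simp add: field_simps)
    then have "a = n * int k" by linarith
    then show "int k dvd a" by simp
  qed (use assms in auto)
  moreover have "\<lfloor>real_of_int a / real k\<rfloor> = a div int k"
    by (metis floor_divide_of_int_eq of_int_of_nat_eq)
  moreover have "real_of_int a / real k - of_int (a div int k) = of_int (a mod int k) / real k"
  proof -
    have "real_of_int a = of_int (a div int k) * real k + of_int (a mod int k)"
      by (metis div_mult_mod_eq of_int_add of_int_mult of_int_of_nat_eq)
    then show ?thesis using assms by (simp add: field_simps)
  qed
  ultimately show ?thesis by (simp add: sawtooth_def)
qed

lemma dedekind_sum_cong_mod:
  assumes "k > 0" and "h mod int k = h' mod int k"
  shows "dedekind_sum h k = dedekind_sum h' k"
proof -
  have "sawtooth (real a * of_int h / real k) = sawtooth (real a * of_int h' / real k)" for a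
  proof -
    obtain n where "h = h' + int k * n"
      using assms(2) by (metis mod_eqE add.commute diff_add_cancel mod_eq_dvd_iff dvdE)
    then have "real a * of_int h / real k = real a * of_int h' / real k + of_int (int a * n)"
      using assms(1) by (simp add: field_simps)
    then show ?thesis by (simp only: sawtooth_add_of_int)
  qed
  then show ?thesis by (simp add: dedekind_sum_def)
qed

lemma dedekind_sum_minus: "dedekind_sum (- h) k = - dedekind_sum h k"
  by (simp add: dedekind_sum_def sawtooth_minus sum_negf)

lemma dedekind_sum_1 [simp]: "dedekind_sum h (Suc 0) = 0"
  by (simp add: dedekind_sum_def sawtooth_def)

lemma abs_dedekind_sum_le: "\<bar>dedekind_sum h k\<bar> \<le> real k / 4"
proof -
  have "\<bar>sawtooth x * sawtooth y\<bar> \<le> 1 / 4" for x y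
    using mult_mono[OF abs_sawtooth_le abs_sawtooth_le, of y x] by (simp add: abs_mult)
  then have "\<bar>dedekind_sum h k\<bar> \<le> (\<Sum>a=1..k. 1 / 4)"
    unfolding dedekind_sum_def by (intro order.trans[OF sum_abs] sum_mono) auto
  then show ?thesis by simp
qed

section \<open>Permuted remainders and lattice point counts\<close>

lemma sum_mult_mod_coprime:
  fixes g :: "int \<Rightarrow> int"
  assumes "coprime h k" and "k > 0"
  shows "(\<Sum>a\<in>{1..<k}. g (a * h mod k)) = (\<Sum>a\<in>{1..<k}. g a)"
proof -
  have inj: "inj_on (\<lambda>a. a * h mod k) {1..<k}"
  proof (rule inj_onI)
    fix a b assume ab: "a \<in> {1..<k}" "b \<in> {1..<k}" "a * h mod k = b * h mod k"
    then have "k dvd (a - b) * h" by (simp add: mod_eq_dvd_iff algebra_simps)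
    then have "k dvd a - b" using assms(1) by (metis coprime_commute coprime_dvd_mult_left_iff)
    then show "a = b" using ab(1,2)
      by (metis atLeastLessThan_iff mod_eq_dvd_iff mod_pos_pos_trivial order_trans zero_le_one)
  qed
  have "(\<lambda>a. a * h mod k) ` {1..<k} \<subseteq> {1..<k}"
  proof clarify
    fix a assume a: "a \<in> {1..<k}"
    have "\<not> k dvd a * h"
      using a assms by (metis atLeastLessThan_iff coprime_commute coprime_dvd_mult_left_iff
          zdvd_not_zless zero_less_one order_less_le_trans)
    then have "a * h mod k \<noteq> 0" by (simp add: dvd_eq_mod_eq_0)
    moreover have "0 \<le> a * h mod k" "a * h mod k < k" using assms by auto
    ultimately show "a * h mod k \<in> {1..<k}" by auto
  qed
  then have "bij_betw (\<lambda>a. a * h mod k) {1..<k} {1..<k}"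
    using inj by (simp add: bij_betw_def endo_inj_surj)
  then show ?thesis by (rule sum.reindex_bij_betw)
qed

text \<open>The only ingredient of \<open>dedekind_sum h k\<close> that is not elementary. It is an
  integer, so reciprocity can be proved over the integers and transferred to the reals at the
  end.\<close>

definition floor_moment :: "int \<Rightarrow> int \<Rightarrow> int" where
  "floor_moment h k = (\<Sum>a\<in>{1..<k}. a * (a * h div k))"

lemma sum_int_lessThan: "(n::int) > 0 \<Longrightarrow> 2 * (\<Sum>a\<in>{1..<n}. a) = n * (n - 1)"
proof (induction n rule: int_gr_induct)
  case base then show ?case by simp
next
  case (step i)
  then have "{1..<i + 1} = insert i {1..<i}" by auto
  then show ?case using step by (simp add: algebra_simps)
qed

lemma sum_int_squares_lessThan: "(n::int) > 0 \<Longrightarrow> 6 * (\<Sum>a\<in>{1..<n}. a^2) = n * (n - 1) * (2 * n - 1)"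
proof (induction n rule: int_gr_induct)
  case base then show ?case by simp
next
  case (step i)
  then have "{1..<i + 1} = insert i {1..<i}" by auto
  then show ?case using step by (simp add: algebra_simps power2_eq_square)
qed

lemma int_le_div_iff:
  fixes m n q :: int
  assumes "q > 0"
  shows "n \<le> m div q \<longleftrightarrow> n * q \<le> m"
proof
  assume "n \<le> m div q"
  then have "n * q \<le> m div q * q" using assms by (simp add: mult_right_mono)
  also have "\<dots> \<le> m" using assms by (simp add: minus_mod_eq_div_mult[symmetric])
  finally show "n * q \<le> m" .
next
  assume "n * q \<le> m"
  from zdiv_mono1[OF this assms] show "n \<le> m div q" using assms by simp
qed

lemma int_div_less_iff:
  fixes m n q :: int
  assumes "q > 0"
  shows "m div q < n \<longleftrightarrow> m < n * q"
  using int_le_div_iff[OF assms, of n m] by linarith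

lemma sum_div_coprime:
  fixes h k :: int
  assumes "coprime h k" and "k > 0"
  shows "2 * (\<Sum>a\<in>{1..<k}. a * h div k) = (h - 1) * (k - 1)"
proof -
  have "(\<Sum>a\<in>{1..<k}. a * h) = (\<Sum>a\<in>{1..<k}. k * (a * h div k) + a * h mod k)"
    by simp
  then have "h * (\<Sum>a\<in>{1..<k}. a) = k * (\<Sum>a\<in>{1..<k}. a * h div k) + (\<Sum>a\<in>{1..<k}. a)"
    using sum_mult_mod_coprime[OF assms, of "\<lambda>x. x"]
    unfolding sum.distrib sum_distrib_left[symmetric] sum_distrib_right[symmetric]
    by (simp add: mult.commute)
  then have "k * (2 * (\<Sum>a\<in>{1..<k}. a * h div k)) = (h - 1) * (2 * (\<Sum>a\<in>{1..<k}. a))"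
    by (simp add: algebra_simps)
  also have "\<dots> = k * ((h - 1) * (k - 1))"
    unfolding sum_int_lessThan[OF assms(2)] by (simp add: algebra_simps)
  finally show ?thesis using assms(2) by simp
qed

text \<open>Lattice points \<open>(a, j)\<close> below the line \<open>j = a h / k\<close>, weighted by \<open>j\<close> and counted by rows.\<close>
lemma sum_div_mult_Suc_div:
  fixes h k :: int
  assumes "coprime h k" and "h > 0" and "k > 0"
  shows "(\<Sum>a\<in>{1..<k}. (a * h div k) * (a * h div k + 1)) = (k - 1) * h * (h - 1) - 2 * floor_moment k h"
proof -
  \<comment> \<open>The product \<open>q * (q + 1)\<close> is summed instead of a square because it
    is exactly twice \<open>1 + ... + q\<close>.\<close>
  have fl: "(a * h div k) * (a * h div k + 1) = 2 * (\<Sum>j | j \<in> {1..<h} \<and> j * k div h < a. j)" if a: "a \<in> {1..<k}" for a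
  proof -
    define q where "q = a * h div k"
    have q0: "q \<ge> 0" using a assms by (simp add: q_def pos_imp_zdiv_nonneg_iff)
    have "a * h < h * k" using a assms by (simp add: mult.commute[of h k])
    then have qh: "q < h" unfolding q_def 
      using assms(3) by (simp add: int_div_less_iff)
    have "{j. j \<in> {1..<h} \<and> j * k div h < a} = {1..<q + 1}"
    proof (intro equalityI subsetI)
      fix j assume j: "j \<in> {j. j \<in> {1..<h} \<and> j * k div h < a}"
      then have "j * k < a * h" using assms by (simp add: int_div_less_iff)
      then have "j \<le> q" unfolding q_def using assms by (simp add: int_le_div_iff)
      with j show "j \<in> {1..<q + 1}" by simp
    next
      fix j assume j: "j \<in> {1..<q + 1}"
      then have "j \<le> a * h div k" by (simp add: q_def)
      then have "j * k \<le> a * h" using assms by (simp add: int_le_div_iff)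
      \<comment> \<open>Coprimality keeps lattice points off the line, so the counts by columns and
        by rows agree without a boundary term.\<close>
      moreover have "j * k \<noteq> a * h"
      proof
        assume "j * k = a * h"
        then have "k dvd a" using assms(1)
          by (metis coprime_commute coprime_dvd_mult_left_iff dvd_triv_right)
        with a show False by (simp add: zdvd_not_zless)
      qed
      ultimately have "j * k div h < a" using assms by (simp add: int_div_less_iff)
      with j qh show "j \<in> {j. j \<in> {1..<h} \<and> j * k div h < a}" by auto
    qed
    then show ?thesis using sum_int_lessThan[of "q + 1"] q0 by (simp add: q_def algebra_simps)
  qed
  have "(\<Sum>a\<in>{1..<k}. (a * h div k) * (a * h div k + 1))
      = 2 * (\<Sum>a\<in>{1..<k}. \<Sum>j | j \<in> {1..<h} \<and> j * k div h < a. j)"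
    by (simp add: fl sum_distrib_left)
  also have "(\<Sum>a\<in>{1..<k}. \<Sum>j | j \<in> {1..<h} \<and> j * k div h < a. j)
      = (\<Sum>j\<in>{1..<h}. \<Sum>a | a \<in> {1..<k} \<and> j * k div h < a. j)"
    by (rule sum.swap_restrict) auto
  also have "\<dots> = (\<Sum>j\<in>{1..<h}. (k - 1 - j * k div h) * j)"
  proof (rule sum.cong[OF refl])
    fix j assume j: "j \<in> {1..<h}"
    have "j * k div h < k" using j assms by (simp add: int_div_less_iff)
    moreover have "j * k div h \<ge> 0" using j assms by (simp add: pos_imp_zdiv_nonneg_iff)
    moreover from this have "{a. a \<in> {1..<k} \<and> j * k div h < a} = {j * k div h + 1..<k}" by auto
    ultimately show "(\<Sum>a | a \<in> {1..<k} \<and> j * k div h < a. j) = (k - 1 - j * k div h) * j" by simp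
  qed
  also have "\<dots> = (k - 1) * (\<Sum>j\<in>{1..<h}. j) - floor_moment k h"
    unfolding floor_moment_def sum_distrib_left sum_subtractf[symmetric]
    by (intro sum.cong refl) (simp add: algebra_simps)
  finally show ?thesis using sum_int_lessThan[OF assms(2)] by (simp add: algebra_simps)
qed

text \<open>The remainders \<open>a * h mod k\<close> permute \<open>1, ..., k - 1\<close>, so their
  squares sum to \<open>Q\<close>. Expanding the squares expresses the same sum by
  \<open>floor_moment h k\<close> and \<open>G\<close>, and the lattice point count exchanges
  \<open>G\<close> for \<open>floor_moment k h\<close>.\<close>

lemma floor_moment_reciprocity:
  fixes h k :: int
  assumes "coprime h k" and "h > 0" and "k > 0"
  shows "12 * h * floor_moment h k + 12 * k * floor_moment k h
    = (h - 1) * (k - 1) * (8 * h * k - h - k - 1)"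
proof -
  define Q where "Q = (\<Sum>a\<in>{1..<k}. a^2)"
  define G where "G = (\<Sum>a\<in>{1..<k}. (a * h div k)^2)"
  have "(a * h mod k)^2 = h^2 * a^2 - 2 * h * k * (a * (a * h div k)) + k^2 * (a * h div k)^2" for a
    by (simp add: minus_mult_div_eq_mod[symmetric] power2_eq_square algebra_simps)
  then have "(\<Sum>a\<in>{1..<k}. (a * h mod k)^2) = h^2 * Q - 2 * h * k * floor_moment h k + k^2 * G"
    by (simp add: Q_def G_def floor_moment_def sum.distrib sum_subtractf sum_distrib_left)
  then have "Q = h^2 * Q - 2 * h * k * floor_moment h k + k^2 * G"
    using sum_mult_mod_coprime[OF assms(1,3), of "\<lambda>x. x^2"] by (simp add: Q_def)
  then have 1: "12 * h * k * floor_moment h k = (h^2 - 1) * (6 * Q) + 6 * k^2 * G"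
    by (simp add: algebra_simps)
  have 2: "6 * Q = k * (k - 1) * (2 * k - 1)" unfolding Q_def by (rule sum_int_squares_lessThan[OF assms(3)])
  have "G + (\<Sum>a\<in>{1..<k}. a * h div k) = (k - 1) * h * (h - 1) - 2 * floor_moment k h"
    using sum_div_mult_Suc_div[OF assms] by (simp add: G_def sum.distrib algebra_simps power2_eq_square)
  then have 3: "2 * G = 2 * (k - 1) * h * (h - 1) - 4 * floor_moment k h - (h - 1) * (k - 1)"
    using sum_div_coprime[OF assms(1,3)] by (simp add: algebra_simps)
  have "k * (12 * h * floor_moment h k) = (h^2 - 1) * (6 * Q) + 3 * k^2 * (2 * G)"
    using 1 by (simp add: algebra_simps)
  also have "\<dots> = k * ((h^2 - 1) * ((k - 1) * (2 * k - 1)) + 3 * k * (2 * (k - 1) * h * (h - 1) - 4 * floor_moment k h - (h - 1) * (k - 1)))"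
    unfolding 2 3 by (simp add: algebra_simps power2_eq_square)
  finally have "12 * h * floor_moment h k = (h^2 - 1) * ((k - 1) * (2 * k - 1)) + 3 * k * (2 * (k - 1) * h * (h - 1) - 4 * floor_moment k h - (h - 1) * (k - 1))"
    using assms(3) by simp
  then show ?thesis by (simp add: algebra_simps power2_eq_square)
qed

lemma dedekind_sum_eq_floor_moment:
  assumes "coprime h (int k)" and "k > 0"
  shows "dedekind_sum h k = of_int h * (real k - 1) * (2 * real k - 1) / (6 * real k)
    - of_int (floor_moment h (int k)) / real k - (real k - 1) / 4"
proof -
  let ?R = "{1..<int k}"
  have bij: "bij_betw int {1..<k} ?R"
    by (rule bij_betw_byWitness[where f' = nat]) auto
  \<comment> \<open>The term \<open>a = k\<close> drops out because \<open>sawtooth\<close> is 0 at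
    integers. For the remaining \<open>a\<close> neither argument is an integer, so this exceptional
    value does not occur again.\<close>
  have "dedekind_sum h k = (\<Sum>a\<in>{1..<k}. sawtooth (real a / real k) * sawtooth (real a * of_int h / real k))"
    unfolding dedekind_sum_def using assms(2)
    by (intro sum.mono_neutral_right) (auto simp: sawtooth_def)
  also have "\<dots> = (\<Sum>a\<in>{1..<k}. (real a / real k - 1/2) * (of_int (int a * h mod int k) / real k - 1/2))"
  proof (rule sum.cong[OF refl])
    fix a assume a: "a \<in> {1..<k}"
    have n: "\<not> int k dvd int a" using a by (auto dest: zdvd_imp_le)
    then have "\<not> int k dvd int a * h" using assms(1)
      by (metis coprime_commute coprime_dvd_mult_left_iff)
    with n a show "sawtooth (real a / real k) * sawtooth (real a * of_int h / real k)
      = (real a / real k - 1/2) * (of_int (int a * h mod int k) / real k - 1/2)"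
      using sawtooth_of_int_div[OF assms(2), of "int a"] sawtooth_of_int_div[OF assms(2), of "int a * h"]
      by (simp add: mod_pos_pos_trivial)
  qed
  also have "\<dots> = (\<Sum>a\<in>?R. (of_int a / real k - 1/2) * (of_int (a * h mod int k) / real k - 1/2))"
    by (subst sum.reindex_bij_betw[OF bij, symmetric]) simp
  also have "\<dots> = (\<Sum>a\<in>?R. of_int (a * (a * h mod int k)) / (real k)^2 - of_int a / (2 * real k)
      - of_int (a * h mod int k) / (2 * real k) + 1/4)"
    using assms(2) by (intro sum.cong refl) (simp add: field_simps power2_eq_square)
  also have "\<dots> = of_int (\<Sum>a\<in>?R. a * (a * h mod int k)) / (real k)^2 - of_int (\<Sum>a\<in>?R. a) / (2 * real k)
      - of_int (\<Sum>a\<in>?R. a * h mod int k) / (2 * real k) + (real k - 1)/4"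
    using assms(2) by (simp add: sum.distrib sum_subtractf sum_divide_distrib of_nat_diff)
  also have "(\<Sum>a\<in>?R. a * h mod int k) = (\<Sum>a\<in>?R. a)"
    using sum_mult_mod_coprime[OF assms(1), of "\<lambda>x. x"] assms(2) by simp
  also have "real_of_int (\<Sum>a\<in>?R. a) = real k * (real k - 1) / 2"
    using arg_cong[OF sum_int_lessThan[of "int k"], of real_of_int] assms(2) by simp
  also have "(\<Sum>a\<in>?R. a * (a * h mod int k)) = h * (\<Sum>a\<in>?R. a^2) - int k * floor_moment h (int k)"
    by (simp add: floor_moment_def minus_mult_div_eq_mod[symmetric] sum_distrib_left
        sum_subtractf[symmetric] algebra_simps power2_eq_square)
  also have "real_of_int \<dots> = of_int h * (real k * (real k - 1) * (2 * real k - 1) / 6) - real k * of_int (floor_moment h (int k))"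
    using arg_cong[OF sum_int_squares_lessThan[of "int k"], of real_of_int] assms(2) by simp
  also have "(of_int h * (real k * (real k - 1) * (2 * real k - 1) / 6)
      - real k * of_int (floor_moment h (int k))) / (real k)\<^sup>2
      = of_int h * (real k - 1) * (2 * real k - 1) / (6 * real k) - of_int (floor_moment h (int k)) / real k"
    using assms(2) by (simp add: field_simps power2_eq_square)
  also have "real k * (real k - 1) / 2 / (2 * real k) = (real k - 1) / 4"
    using assms(2) by simp
  finally show ?thesis by simp
qed

theorem dedekind_sum_reciprocity:
  assumes "coprime h k" and "h > 0" and "k > 0"
  shows "dedekind_sum (int h) k + dedekind_sum (int k) h
    = - 1 / 4 + (real h / real k + real k / real h + 1 / (real h * real k)) / 12"
proof -
  have c: "coprime (int h) (int k)" "coprime (int k) (int h)"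
    using assms(1) by (simp_all add: coprime_commute)
  have "12 * real h * of_int (floor_moment h k) + 12 * real k * of_int (floor_moment k h)
    = (real h - 1) * (real k - 1) * (8 * real h * real k - real h - real k - 1)"
    using arg_cong[OF floor_moment_reciprocity[OF c(1)], of real_of_int] assms by simp
  then have e: "real_of_int (floor_moment k h) = ((real h - 1) * (real k - 1) * (8 * real h * real k - real h - real k - 1) - 12 * real h * of_int (floor_moment h k)) / (12 * real k)"
    using assms by (simp add: field_simps)
  show ?thesis
    unfolding dedekind_sum_eq_floor_moment[OF c(1) assms(3)] dedekind_sum_eq_floor_moment[OF c(2) assms(2)] e
    using assms(2,3) by (simp add: field_simps)
qed

section \<open>Dedekind sums near rational points\<close>

lemma coprime_diff_mult_int:
  fixes h k c :: int
  shows "coprime (h - k * c) k \<longleftrightarrow> coprime h k"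
  using gcd_add_mult[of k "- c" h] by (simp add: coprime_iff_gcd_eq_1 gcd.commute algebra_simps)

text \<open>The fractions on the right are the main terms of Rademacher's three-term reciprocity for
  \<open>(k, d, r)\<close> and \<open>(H, C, - r)\<close>. Since the identity is exact, inverting
  both fractions transports an error bound without enlarging it.\<close>

lemma three_term_identity:
  fixes H k C d r :: real
  assumes "H \<noteq> 0" "k \<noteq> 0" "C \<noteq> 0" "d \<noteq> 0" "r \<noteq> 0" and r: "r = H * d - k * C"
  shows "(H / k + k / H + 1 / (H * k)) - (C / d + d / C + 1 / (C * d))
    = (k^2 + d^2 + r^2) / (k * d * r) + (H^2 + C^2 + r^2) / (H * C * (- r))"
proof -
  have 1: "H / k - C / d = r / (k * d)" "k / H - d / C = - r / (H * C)"
    using assms(1-5) by (simp_all add: r divide_simps)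
  have 2: "(k / d - H / C) / r = - 1 / (C * d)" "(d / k - C / H) / r = 1 / (H * k)"
    using assms(1-5) by (simp_all add: r divide_simps)
  have "(k^2 + d^2 + r^2) / (k * d * r) = (k / d + d / k) / r + r / (k * d)"
    using assms(1-5) by (simp add: field_simps power2_eq_square)
  moreover have "(H^2 + C^2 + r^2) / (H * C * (- r)) = - ((H / C + C / H) / r) - r / (H * C)"
    using assms(1-5) by (simp add: field_simps power2_eq_square)
  ultimately show ?thesis using 1 2 by (simp add: diff_divide_distrib add_divide_distrib)
qed

text \<open>
  The quantity estimated here is unchanged when \<open>(h, c)\<close> is translated by \<open>(n k, n d)\<close>, and by
  reciprocity it changes sign when both fractions \<open>h / k\<close> and \<open>c / d\<close> are inverted. Euclid's algorithm
  for \<open>c / d\<close> therefore reduces everything to \<open>c / d = 0 / 1\<close>.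
\<close>
lemma dedekind_sum_three_term_bound:
  fixes h c r :: int and k d :: nat
  assumes "coprime h (int k)" and "coprime c (int d)" and "k > 0" and "d > 0"
    and "r = h * int d - int k * c" and "r \<noteq> 0" and "(int d - 1) * \<bar>r\<bar> < int k"
  shows "\<bar>dedekind_sum h k - dedekind_sum c d
      - ((real k)^2 + (real d)^2 + (of_int r)^2) / (12 * (real k * real d * of_int r))\<bar>
    \<le> \<bar>of_int r\<bar> / 4 + 1 / 4"
  using assms
proof (induction d arbitrary: h k c r rule: less_induct)
  case (less d)
  show ?case
  proof (cases "d = 1")
    case True
    define t where "t = nat \<bar>r\<bar>"
    have t: "t > 0" "real t = \<bar>of_int r\<bar>" using less.prems(6) by (auto simp: t_def)
    have rr: "r = h - int k * c" using True less.prems(5) by simp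
    have "coprime r (int k)" using less.prems(1) by (simp add: rr coprime_diff_mult_int)
    then have cop: "coprime t k" by (simp add: t_def flip: coprime_int_iff)
    have "h mod int k = r mod int k" by (simp add: rr mod_diff_eq[symmetric] mod_eq_dvd_iff)
    then have sr: "dedekind_sum h k = dedekind_sum r k" by (rule dedekind_sum_cong_mod[OF less.prems(3)])
    have X: "(real t / real k + real k / real t + 1 / (real t * real k)) / 12
        = ((real k)^2 + 1 + (real t)^2) / (12 * (real k * real t))"
      using t(1) less.prems(3) by (simp add: field_simps power2_eq_square)
    have rec: "dedekind_sum (int t) k = - 1/4 + ((real k)^2 + 1 + (real t)^2) / (12 * (real k * real t)) - dedekind_sum (int k) t"
      using dedekind_sum_reciprocity[OF cop t(1) less.prems(3)] X by simp
    \<comment> \<open>The only estimate in the induction: the third Dedekind sum of the three-term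
      law has modulus \<open>|r|\<close> and is bounded trivially. With the constant
      \<open>1 / 4\<close> of reciprocity this gives the claimed bound, which the induction step
      preserves because \<open>|r|\<close> does not change.\<close>
    have b: "dedekind_sum (int k) t \<le> real t / 4" "- dedekind_sum (int k) t \<le> real t / 4"
      using abs_dedekind_sum_le[of "int k" t] by linarith+
    show ?thesis
    proof (cases "r > 0")
      case rp: True
      then have "int t = r" by (simp add: t_def)
      then show ?thesis using rec b sr rp True t by (simp add: abs_le_iff)
    next
      case False
      then have rt: "r = - int t" by (simp add: t_def)
      then have "dedekind_sum h k = 1/4 - ((real k)^2 + 1 + (real t)^2) / (12 * (real k * real t)) + dedekind_sum (int k) t"
        unfolding sr rt dedekind_sum_minus rec by simp
      then show ?thesis unfolding True rt using b by (simp add: abs_le_iff)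
    qed
  next
    case False
    with less.prems(4) have d2: "d \<ge> 2" by simp
    define n where "n = c div int d"
    define C where "C = nat (c mod int d)"
    have c0: "c mod int d \<noteq> 0"
    proof
      assume "c mod int d = 0"
      then have "int d dvd c" by (simp add: dvd_eq_mod_eq_0)
      then have "int d dvd 1" using coprime_common_divisor[OF less.prems(2), of "int d"] by simp
      then show False using d2 by (simp add: zdvd1_eq)
    qed
    have "0 \<le> c mod int d" "c mod int d < int d" using less.prems(4) by simp_all
    with c0 have C: "int C = c mod int d" "0 < C" "C < d" by (auto simp: C_def)
    have h0d: "(h - int k * n) * int d = int k * int C + r"
      unfolding less.prems(5) n_def C(1) by (simp add: algebra_simps minus_div_mult_eq_mod[symmetric])
    have cC: "1 \<le> int C" using C by simp
    have d1: "1 \<le> int d - 1" using d2 by simp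
    \<comment> \<open>For \<open>d >= 2\<close> the size hypothesis yields \<open>|r| < k\<close>,
      which makes \<open>H\<close> positive, so that it can serve as a modulus.\<close>
    have rk: "\<bar>r\<bar> < int k"
      using less.prems(7) mult_right_mono[OF d1, of "\<bar>r\<bar>"] by simp
    then have "0 < int k * int C + r"
      using mult_left_mono[OF cC, of "int k"] by simp
    with h0d have h0: "h - int k * n > 0" by (metis less.prems(4) of_nat_0_less_iff zero_less_mult_pos2)
    define H where "H = nat (h - int k * n)"
    have H: "int H = h - int k * n" "0 < H" using h0 by (auto simp: H_def)
    have Hd: "int H * int d = int k * int C + r" using h0d H by simp
    have sh: "dedekind_sum h k = dedekind_sum (int H) k"
      by (rule dedekind_sum_cong_mod[OF less.prems(3)]) (simp add: H(1) mod_eq_dvd_iff)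
    have sc: "dedekind_sum c d = dedekind_sum (int C) d"
      by (rule dedekind_sum_cong_mod[OF less.prems(4)]) (simp add: C(1))
    have copH: "coprime (int H) (int k)" using less.prems(1) by (simp add: H(1) coprime_diff_mult_int)
    have copC: "coprime (int C) (int d)" using less.prems(2) C(1)
      by (simp add: coprime_iff_gcd_eq_1 gcd_red_int[symmetric] gcd.commute)
    \<comment> \<open>The reason for the factor \<open>int d - 1\<close> in the size hypothesis:
      \<open>C < d\<close> leaves a spare \<open>|r|\<close>, which pays for the \<open>r\<close> in
      \<open>H d = k C + r\<close>, so the hypothesis is inherited. With the factor \<open>d\<close>
      it would not be.\<close>
    have "(int C - 1) * \<bar>- r\<bar> < int H"
    proof -
      have "int d * ((int C - 1) * \<bar>r\<bar>) < int d * int H"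
      proof -
        have "int d * ((int C - 1) * \<bar>r\<bar>) \<le> (int C * (int d - 1) - 1) * \<bar>r\<bar>"
        proof -
          have "int d * (int C - 1) \<le> int C * (int d - 1) - 1" using C(3) by (simp add: algebra_simps)
          from mult_right_mono[OF this, of "\<bar>r\<bar>"] show ?thesis by (simp add: mult.assoc)
        qed
        also have "\<dots> = int C * ((int d - 1) * \<bar>r\<bar>) - \<bar>r\<bar>" by (simp add: algebra_simps)
        also have "\<dots> < int C * int k - \<bar>r\<bar>"
          using less.prems(7) C(2) by simp
        also have "\<dots> \<le> int d * int H" using Hd by (simp add: mult.commute)
        finally show ?thesis .
      qed
      then show ?thesis using mult_less_cancel_left_pos[of "int d"] less.prems(4) by simp
    qed
    from this have IH: "\<bar>dedekind_sum (int k) H - dedekind_sum (int d) C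
      - ((real H)^2 + (real C)^2 + (of_int (- r))^2) / (12 * (real H * real C * of_int (- r)))\<bar>
      \<le> \<bar>of_int (- r)\<bar> / 4 + 1 / 4"
    proof (rule less.IH[OF C(3) _ _ H(2) C(2), rotated -1])
      show "coprime (int k) (int H)" "coprime (int d) (int C)"
        using copH copC by (simp_all only: coprime_commute)
      show "- r = int k * int C - int H * int d" using Hd by simp
      show "- r \<noteq> 0" using less.prems(6) by simp
    qed
    have r1: "dedekind_sum (int H) k + dedekind_sum (int k) H = - 1/4 + (real H / real k + real k / real H + 1 / (real H * real k)) / 12"
      by (rule dedekind_sum_reciprocity[OF _ H(2) less.prems(3)]) (use copH in \<open>simp only: coprime_int_iff\<close>)
    have r2: "dedekind_sum (int C) d + dedekind_sum (int d) C = - 1/4 + (real C / real d + real d / real C + 1 / (real C * real d)) / 12"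
      by (rule dedekind_sum_reciprocity[OF _ C(2) less.prems(4)]) (use copC in \<open>simp only: coprime_int_iff\<close>)
    have rr: "real_of_int r = real H * real d - real k * real C"
      using arg_cong[OF Hd, of real_of_int] by simp
    have id: "(real H / real k + real k / real H + 1 / (real H * real k)) - (real C / real d + real d / real C + 1 / (real C * real d))
      = ((real k)^2 + (real d)^2 + (of_int r)^2) / (real k * real d * of_int r)
        + ((real H)^2 + (real C)^2 + (of_int r)^2) / (real H * real C * (- of_int r))"
    proof (rule three_term_identity[OF _ _ _ _ _ rr])
      show "real_of_int r \<noteq> 0" using less.prems(6) by (simp only: of_int_eq_0_iff not_False_eq_True)
    qed (use H(2) C(2) less.prems(3,4) in auto)
    have tw: "a / (12 * b) = a / b / 12" for a b :: real by simp
    have "dedekind_sum h k - dedekind_sum c d - ((real k)^2 + (real d)^2 + (of_int r)^2) / (12 * (real k * real d * of_int r))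
      = - (dedekind_sum (int k) H - dedekind_sum (int d) C
      - ((real H)^2 + (real C)^2 + (of_int (- r))^2) / (12 * (real H * real C * of_int (- r))))"
    proof -
      have "a1 - a2 - x / 12 = - (b1 - b2 - y / 12)"
        if "a1 + b1 = - 1/4 + u / 12" "a2 + b2 = - 1/4 + v / 12" "u - v = x + y"
        for a1 a2 b1 b2 u v x y :: real
        using that by (simp add: field_simps)
      from this[OF r1 r2 id] show ?thesis unfolding tw sh sc of_int_minus power2_minus .
    qed
    then show ?thesis using IH by simp
  qed
qed

text \<open>Of the three-term main term only \<open>k / (12 d r)\<close> is kept. The sum
  \<open>s(c, d)\<close>, the error \<open>|r| / 4 + 1 / 4\<close> and the two remaining fractions
  are at most \<open>1/4\<close>, \<open>1/4 + 1/4\<close> and \<open>1/6\<close> times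
  \<open>d |r|\<close>, in total less than \<open>d |r|\<close>.\<close>

lemma dedekind_sum_near_fraction:
  fixes h c r :: int and k d :: nat
  assumes "coprime h (int k)" and "coprime c (int d)" and "k > 0" and "d > 0"
    and "r = h * int d - int k * c" and "r \<noteq> 0" and "int d * \<bar>r\<bar> \<le> int k"
  shows "\<bar>dedekind_sum h k - real k / (12 * (real d * of_int r))\<bar> \<le> real d * \<bar>of_int r\<bar>"
proof -
  define t where "t = \<bar>real_of_int r\<bar>"
  have t1: "t \<ge> 1" using assms(6) unfolding t_def by linarith
  have d1: "real d \<ge> 1" using assms(4) by simp
  have "real_of_int (int d * \<bar>r\<bar>) \<le> real_of_int (int k)" using assms(7) by (simp only: of_int_le_iff)
  then have dt: "real d * t \<le> real k" by (simp add: t_def)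
  have n: "real d \<le> real d * t" "t \<le> real d * t" "1 \<le> real d * t"
    using t1 d1 mult_mono[OF d1 t1] by auto
  have "\<bar>dedekind_sum h k - dedekind_sum c d
      - ((real k)^2 + (real d)^2 + (of_int r)^2) / (12 * (real k * real d * of_int r))\<bar> \<le> t / 4 + 1 / 4"
    unfolding t_def using assms by (intro dedekind_sum_three_term_bound) (auto simp: algebra_simps)
  moreover have "((real k)^2 + (real d)^2 + (of_int r)^2) / (12 * (real k * real d * of_int r))
      = real k / (12 * (real d * of_int r)) + (real d / (real k * of_int r) + of_int r / (real k * real d)) / 12"
    using assms by (simp add: field_simps power2_eq_square)
  moreover have "\<bar>real d / (real k * of_int r)\<bar> \<le> 1"
  proof -
    have "real d \<le> real k * t" using n dt t1 mult_mono[of 1 "real k" 1 t] d1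
      by (smt (verit) mult_left_mono mult_cancel_left2)
    then show ?thesis using assms t1 by (simp add: abs_mult t_def divide_le_eq)
  qed
  moreover have "\<bar>of_int r / (real k * real d)\<bar> \<le> 1"
  proof -
    have "t \<le> real k * real d" using n dt d1
      by (smt (verit) mult_left_mono mult_cancel_left2)
    then show ?thesis using assms t1 by (simp add: abs_mult t_def divide_le_eq)
  qed
  moreover have "\<bar>dedekind_sum c d\<bar> \<le> real d / 4" by (rule abs_dedekind_sum_le)
  moreover have "\<bar>s - m\<bar> \<le> p" if "\<bar>s - s' - v\<bar> \<le> t / 4 + 1 / 4" "v = m + (a + b) / 12"
    "\<bar>a\<bar> \<le> 1" "\<bar>b\<bar> \<le> 1" "\<bar>s'\<bar> \<le> e / 4" "e \<le> p" "t \<le> p" "1 \<le> p" for s s' v m a b e p :: real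
    using that unfolding abs_le_iff by (simp add: field_simps)
  ultimately show ?thesis using n unfolding t_def[symmetric] by blast
qed

text \<open>
  \<open>x\<close> and \<open>y\<close> are consecutive remainders in Euclid's algorithm for \<open>k / h\<close>, and \<open>q'\<close>, \<open>q\<close> are the
  denominators of the corresponding convergents.
\<close>
lemma dedekind_sum_euclid_bound:
  fixes h e :: int and k x y q q' :: nat and n :: real
  assumes pairs: "\<And>q y. q > 0 \<Longrightarrow> y \<noteq> 0 \<Longrightarrow> int k dvd int q * h - y \<Longrightarrow> n \<le> real q * \<bar>of_int y\<bar>"
    and n: "0 < n" "n \<le> real k" and e: "\<bar>e\<bar> = 1"
  assumes "0 < y" "y \<le> x" "coprime x y" "0 < q" "q * x + q' * y = k"
    "int k dvd int q * h - e * int y" "int k dvd int q' * h + e * int x"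
  shows "\<bar>dedekind_sum (int y) x\<bar> \<le> real k / n * (1 + log 2 (real x * real y))"
  using e assms(5-)
proof (induction y arbitrary: x q q' e rule: less_induct)
  case (less y)
  have x0: "x > 0" using less.prems by simp
  have kn: "1 \<le> real k / n" using n by simp
  \<comment> \<open>The pair \<open>(q, e * y)\<close> satisfies the congruence, so
    \<open>q * y\<close> is at least \<open>n\<close>, while \<open>q * x\<close> is at most
    \<open>k\<close>. Hence \<open>x / y\<close>, essentially a partial quotient, is at most
    \<open>k / n\<close>, and by reciprocity one Euclidean step costs no more than that.\<close>
  have "n \<le> real q * real y"
  proof -
    have "e \<noteq> 0" "\<bar>real_of_int e\<bar> = 1" using less.prems(1) by (auto simp flip: of_int_abs)
    then show ?thesis using pairs[of q "e * int y"] less.prems by (simp add: abs_mult)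
  qed
  moreover have "real q * real x \<le> real k" using less.prems(6) by (metis le_add1 of_nat_le_iff of_nat_mult)
  ultimately have "real x * n \<le> real y * real k"
    by (smt (verit) mult.commute mult.left_commute mult_left_mono of_nat_0_le_iff)
  then have xy: "real x / real y \<le> real k / n" using n less.prems by (simp add: field_simps)
  have small: "real y / real x \<le> 1" "1 / (real y * real x) \<le> 1"
    using less.prems x0 by (auto simp: divide_le_eq simp flip: of_nat_mult)
  have small0: "0 \<le> real y / real x" "0 \<le> 1 / (real y * real x)" "0 \<le> real x / real y" by auto
  have rec: "dedekind_sum (int y) x + dedekind_sum (int x) y
    = - 1 / 4 + (real y / real x + real x / real y + 1 / (real y * real x)) / 12"
    using less.prems x0 by (intro dedekind_sum_reciprocity) (auto simp: coprime_commute)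
  have step: "\<bar>dedekind_sum (int y) x\<bar> \<le> \<bar>dedekind_sum (int x) y\<bar> + real k / n"
  proof -
    have "\<bar>s\<bar> \<le> \<bar>s'\<bar> + b" if "s + s' = - 1 / 4 + (u + v + t) / 12" "u \<le> 1" "t \<le> 1" "0 \<le> u" "0 \<le> t"
      "0 \<le> v" "v \<le> b" "1 \<le> b" for s s' u v t b :: real
    proof -
      have "\<bar>s + s'\<bar> \<le> b" using that(2-) unfolding that(1) abs_le_iff by (simp add: field_simps)
      then show ?thesis by linarith
    qed
    from this[OF rec small small0(1,2,3) xy kn] show ?thesis .
  qed
  show ?case
  proof (cases "y = 1")
    case True
    have "0 \<le> log 2 (real x * real y)" using True x0 by simp
    then have "real k / n * 1 \<le> real k / n * (1 + log 2 (real x * real y))"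
      using kn by (intro mult_left_mono) auto
    then show ?thesis using step True by simp
  next
    case False
    define z where "z = x mod y"
    define a where "a = x div y"
    have xa: "x = a * y + z" by (simp add: a_def z_def)
    have zy: "z < y" using less.prems by (simp add: z_def)
    have z0: "z > 0" using less.prems(4) False unfolding z_def
      by (metis coprime_commute coprime_absorb_left dvd_eq_mod_eq_0 gr0I nat_dvd_1_iff_1)
    have "a \<ge> 1" using less.prems unfolding a_def by (simp add: Suc_leI div_greater_zero_iff)
    then have "y \<le> a * y" by simp
    then have x2: "2 * z \<le> x" using zy unfolding xa by linarith
    have cop: "coprime y z" using less.prems(4) unfolding z_def
      by (metis coprime_commute coprime_mod_right_iff less.prems(2) not_gr_zero)
    \<comment> \<open>The next convergent has denominator \<open>a * q + q'\<close>; convergents lie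
      alternately on both sides of the fraction, hence the change of sign of
      \<open>e\<close>.\<close>
    have "\<bar>dedekind_sum (int z) y\<bar> \<le> real k / n * (1 + log 2 (real y * real z))"
    proof (rule less.IH[OF zy, of "- e" y "a * q + q'" q])
      show "\<bar>- e\<bar> = 1" "0 < z" "z \<le> y" "coprime y z" "0 < a * q + q'"
        using less.prems z0 zy cop \<open>a \<ge> 1\<close> by auto
      show "(a * q + q') * y + q * z = k"
        using less.prems(6) by (simp add: xa algebra_simps)
      have "int k dvd int a * (int q * h - e * int y) + (int q' * h + e * int x)"
        using less.prems by simp
      then show "int k dvd int (a * q + q') * h - - e * int z"
        by (simp add: xa algebra_simps)
      show "int k dvd int q * h + - e * int y" using less.prems by simp
    qed
    also have "dedekind_sum (int z) y = dedekind_sum (int x) y"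
      using less.prems(2) by (intro dedekind_sum_cong_mod) (auto simp: z_def zmod_int)
    finally have b: "\<bar>dedekind_sum (int x) y\<bar> \<le> real k / n * (1 + log 2 (real y * real z))" .
    \<comment> \<open>The product of consecutive remainders at least halves, since
      \<open>2 * z <= x\<close>. So its binary logarithm pays for the \<open>k / n\<close> of each
      step.\<close>
    have "1 + log 2 (real y * real z) = log 2 (2 * (real y * real z))"
      using z0 less.prems(2) by (simp add: log_mult)
    also have "\<dots> \<le> log 2 (real x * real y)"
    proof -
      have "2 * (real y * real z) \<le> real x * real y"
        using x2 by (metis mult.commute mult.left_commute mult_le_mono2 of_nat_le_iff of_nat_mult of_nat_numeral)
      then show ?thesis using z0 less.prems(2) by (subst log_le_cancel_iff) auto
    qed
    finally have "real k / n * (1 + log 2 (real y * real z)) \<le> real k / n * log 2 (real x * real y)"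
      using kn by (intro mult_left_mono) auto
    then show ?thesis using b step by (simp add: algebra_simps)
  qed
qed

section \<open>Dirichlet convolution and gcd sums\<close>

lemma has_sum_Sigma_nonneg:
  fixes f :: "'a \<times> 'b \<Rightarrow> real"
  assumes "\<And>x. x \<in> A \<Longrightarrow> ((\<lambda>y. f (x, y)) has_sum g x) (B x)" and "(g has_sum S) A"
    and "\<And>x y. x \<in> A \<Longrightarrow> y \<in> B x \<Longrightarrow> 0 \<le> f (x, y)"
  shows "(f has_sum S) (Sigma A B)"
proof (rule has_sum_SigmaI)
  show "f summable_on Sigma A B"
    by (rule summable_on_SigmaI) (use assms has_sum_imp_summable in auto)
qed (use assms in auto)

section \<open>Zeta values at real arguments as unordered sums\<close>

definition zeta_real :: "real \<Rightarrow> real" where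
  "zeta_real w = (\<Sum>\<^sub>\<infinity>n\<in>{0<..}. real n powr - w)"

lemma has_sum_zeta_real:
  assumes "w > 1"
  shows "((\<lambda>n. real n powr - w) has_sum zeta_real w) {0<..}"
proof -
  have "summable (\<lambda>n. real n powr - w)" using assms by (simp add: summable_real_powr_iff)
  then have "(\<lambda>n. real n powr - w) summable_on UNIV"
    by (intro summable_nonneg_imp_summable_on) auto
  then have "(\<lambda>n. real n powr - w) summable_on {0<..}"
    by (rule summable_on_subset) auto
  then show ?thesis by (simp add: zeta_real_def)
qed

lemma zeta_real_sums:
  assumes "w > 1"
  shows "(\<lambda>n. 1 / real (Suc n) powr w) sums zeta_real w"
proof -
  have "bij_betw Suc UNIV {0<..}" by (rule bij_betw_byWitness[where f' = "\<lambda>n. n - 1"]) auto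
  then have "((\<lambda>n. real (Suc n) powr - w) has_sum zeta_real w) UNIV"
    using has_sum_zeta_real[OF assms] by (subst has_sum_reindex_bij_betw)
  then show ?thesis by (drule_tac has_sum_imp_sums) (simp add: powr_minus_divide)
qed

lemma zeta_of_real:
  assumes "w > 1"
  shows "zeta (of_real w) = of_real (zeta_real w)"
proof -
  have "(\<lambda>n. complex_of_real (1 / real (Suc n) powr w)) sums of_real (zeta_real w)"
    using zeta_real_sums[OF assms] by (rule sums_of_real)
  then have "(\<lambda>n. 1 / of_nat (Suc n) powr complex_of_real w) sums of_real (zeta_real w)"
    by (simp add: powr_of_real[symmetric] del: of_nat_Suc)
  then show ?thesis unfolding zeta_def by (rule sums_unique[symmetric])
qed

lemma zeta_real_pos:
  assumes "w > 1"
  shows "zeta_real w > 0"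
proof -
  have "(\<Sum>n\<in>{1::nat}. real n powr - w) \<le> zeta_real w"
    by (rule finite_sum_le_has_sum[OF has_sum_zeta_real[OF assms]]) auto
  then show ?thesis by simp
qed

text \<open>For \<open>n = 0\<close> the index set is infinite and the sum takes its default value
  0; positivity is therefore assumed wherever factorisations are enumerated.\<close>

definition dirichlet_conv :: "(nat \<Rightarrow> real) \<Rightarrow> (nat \<Rightarrow> real) \<Rightarrow> nat \<Rightarrow> real" where
  "dirichlet_conv a b n = (\<Sum>(i, j) | i * j = n. a i * b j)"

lemma finite_factorisations: "n > 0 \<Longrightarrow> finite {(i, j). i * j = (n::nat)}"
proof (rule finite_subset)
  assume "n > 0"
  then show "{(i, j). i * j = n} \<subseteq> {..n} \<times> {..n}" by (auto simp: Suc_leI)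
qed simp

lemma dirichlet_conv_cong:
  assumes "n > 0" and "\<And>i. i > 0 \<Longrightarrow> a i = a' i" and "\<And>i. i > 0 \<Longrightarrow> b i = b' i"
  shows "dirichlet_conv a b n = dirichlet_conv a' b' n"
  unfolding dirichlet_conv_def using assms by (intro sum.cong) auto

lemma dirichlet_conv_cmult_right: "dirichlet_conv a (\<lambda>i. c * b i) n = c * dirichlet_conv a b n"
  unfolding dirichlet_conv_def sum_distrib_left by (intro sum.cong) auto

lemma dirichlet_conv_commute: "dirichlet_conv a b n = dirichlet_conv b a n"
  unfolding dirichlet_conv_def
  by (rule sum.reindex_bij_witness[of _ prod.swap prod.swap]) (auto simp: mult.commute)

lemma dirichlet_conv_assoc:
  assumes "n > 0"
  shows "dirichlet_conv (dirichlet_conv a b) c n = dirichlet_conv a (dirichlet_conv b c) n"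
proof -
  have "dirichlet_conv (dirichlet_conv a b) c n
    = (\<Sum>(x, y)\<in>{(x, y). x * y = n}. \<Sum>(i, j)\<in>{(i, j). i * j = x}. a i * b j * c y)"
    unfolding dirichlet_conv_def by (intro sum.cong) (auto simp: sum_distrib_right case_prod_unfold)
  also have "\<dots> = (\<Sum>((x, y), (i, j))\<in>(SIGMA (x, y):{(x, y). x * y = n}. {(i, j). i * j = x}). a i * b j * c y)"
    using assms by (subst sum.Sigma[symmetric]) (auto simp: case_prod_unfold intro!: finite_factorisations[unfolded case_prod_unfold])
  also have "\<dots> = (\<Sum>((x, y), (i, j))\<in>(SIGMA (x, y):{(x, y). x * y = n}. {(i, j). i * j = y}). a x * b i * c j)"
    by (rule sum.reindex_bij_witness[of _ "\<lambda>((x, y), (i, j)). ((x * i, j), (x, i))" "\<lambda>((x, y), (i, j)). ((i, j * y), (j, y))"]) auto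
  also have "\<dots> = (\<Sum>(x, y)\<in>{(x, y). x * y = n}. \<Sum>(i, j)\<in>{(i, j). i * j = y}. a x * b i * c j)"
    using assms by (subst sum.Sigma[symmetric]) (auto simp: case_prod_unfold intro!: finite_factorisations[unfolded case_prod_unfold])
  also have "\<dots> = dirichlet_conv a (dirichlet_conv b c) n"
    unfolding dirichlet_conv_def by (intro sum.cong) (auto simp: sum_distrib_left case_prod_unfold mult.assoc)
  finally show ?thesis .
qed

text \<open>The factorisation \<open>1 * n\<close> contributes \<open>b n\<close> itself, and all
  others involve \<open>b\<close> only at smaller arguments.\<close>

lemma dirichlet_conv_left_cancel:
  assumes "\<And>n. n > 0 \<Longrightarrow> dirichlet_conv a b n = dirichlet_conv a c n" and "a 1 = 1" and "n > 0"
  shows "b n = c n"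
  using assms(3)
proof (induction n rule: less_induct)
  case (less n)
  have "dirichlet_conv a g n = g n + (\<Sum>(i, j)\<in>{(i, j). i * j = n} - {(1, n)}. a i * g j)" for g
    unfolding dirichlet_conv_def using less.prems assms(2)
    by (subst sum.remove[of _ "(1, n)"]) (auto simp: finite_factorisations)
  moreover have "(\<Sum>(i, j)\<in>{(i, j). i * j = n} - {(1, n)}. a i * b j) = (\<Sum>(i, j)\<in>{(i, j). i * j = n} - {(1, n)}. a i * c j)"
  proof (rule sum.cong[OF refl])
    fix x assume "x \<in> {(i, j). i * j = n} - {(1, n)}"
    then obtain i j where x: "x = (i, j)" "i * j = n" "i \<noteq> 1" by (cases x) auto
    with less.prems have "i > 1" "j > 0" by (cases i; auto)+
    then have "j < n" using x(2) by auto
    then show "(\<lambda>(i, j). a i * b j) x = (\<lambda>(i, j). a i * c j) x"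
      using less.IH \<open>j > 0\<close> x(1) by simp
  qed
  ultimately show ?case using assms(1)[OF less.prems] by simp
qed

text \<open>Every positive \<open>d\<close> is uniquely \<open>u e\<close> with \<open>u = gcd d k\<close> and \<open>e\<close> coprime to \<open>k / u\<close>.\<close>
lemma has_sum_split_gcd:
  fixes f :: "nat \<Rightarrow> real"
  assumes "k > 0"
  shows "((\<lambda>((u, v), e). f (u * e)) has_sum S) (SIGMA (u, v):{(u, v). u * v = k}. {e. e > 0 \<and> coprime e v})
    \<longleftrightarrow> (f has_sum S) {0<..}"
proof (rule has_sum_reindex_bij_witness[of _ "\<lambda>d. ((gcd d k, k div gcd d k), d div gcd d k)" "\<lambda>((u, v), e). u * e"])
  fix x assume "x \<in> (SIGMA (u, v):{(u, v). u * v = k}. {e. e > 0 \<and> coprime e v})"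
  then obtain u v e where x: "x = ((u, v), e)" "u * v = k" "e > 0" "coprime e v" by auto
  then have "gcd (u * e) k = u" by (auto simp: gcd_mult_distrib_nat[symmetric])
  then show "(\<lambda>d. ((gcd d k, k div gcd d k), d div gcd d k)) ((\<lambda>((u, v), e). u * e) x) = x"
    using x assms by auto
  show "(\<lambda>((u, v), e). u * e) x \<in> {0<..}" using x assms by auto
  show "f ((\<lambda>((u, v), e). u * e) x) = (\<lambda>((u, v), e). f (u * e)) x" using x by simp
next
  fix d :: nat assume d: "d \<in> {0<..}"
  then have "coprime (d div gcd d k) (k div gcd d k)" by (intro div_gcd_coprime) auto
  then show "((gcd d k, k div gcd d k), d div gcd d k) \<in> (SIGMA (u, v):{(u, v). u * v = k}. {e. e > 0 \<and> coprime e v})"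
    using d assms by (auto simp: div_greater_zero_iff gcd_le1_nat)
qed auto

text \<open>For positive \<open>v\<close> this is zeta at \<open>w\<close> without the Euler factors
  at the primes dividing \<open>v\<close>, in a form that needs no Euler product.\<close>

definition coprime_zeta :: "real \<Rightarrow> nat \<Rightarrow> real" where
  "coprime_zeta w v = (\<Sum>\<^sub>\<infinity>e | e > 0 \<and> coprime e v. real e powr - w)"

lemma has_sum_coprime_zeta:
  assumes "w > 1"
  shows "((\<lambda>e. real e powr - w) has_sum coprime_zeta w v) {e. e > 0 \<and> coprime e v}"
  unfolding coprime_zeta_def
  by (intro has_sum_infsum summable_on_subset[OF has_sum_imp_summable[OF has_sum_zeta_real[OF assms]]]) auto

text \<open>Sorting the series for zeta by the gcd of its index with \<open>k\<close>. Convolution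
  with \<open>u powr - w\<close> thus turns \<open>coprime_zeta\<close> into a constant.\<close>

lemma dirichlet_conv_powr_coprime_zeta:
  assumes "w > 1" and "k > 0"
  shows "dirichlet_conv (\<lambda>u. real u powr - w) (coprime_zeta w) k = zeta_real w"
proof -
  have "((\<lambda>((u, v), e). real (u * e) powr - w) has_sum zeta_real w)
      (SIGMA (u, v):{(u, v). u * v = k}. {e. e > 0 \<and> coprime e v})"
    using has_sum_zeta_real[OF assms(1)] by (subst has_sum_split_gcd[OF assms(2)])
  then have "((\<lambda>(u, v). real u powr - w * coprime_zeta w v) has_sum zeta_real w) {(u, v). u * v = k}"
    by (rule has_sum_SigmaD)
      (auto simp: powr_mult intro!: has_sum_cmult_right has_sum_coprime_zeta assms)
  from has_sum_unique[OF this has_sum_finite[OF finite_factorisations[OF assms(2)]]]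
  show ?thesis by (simp add: dirichlet_conv_def)
qed

text \<open>The weight comes from counting triples: with \<open>g = gcd d k\<close>, each nonzero
  multiple \<open>r\<close> of \<open>g\<close> is hit by \<open>g\<close> residues
  \<open>h\<close>, and summing \<open>|r| powr - w\<close> over these multiples produces the factor
  \<open>g powr - w\<close>.\<close>

definition gcd_sum :: "real \<Rightarrow> nat \<Rightarrow> real" where
  "gcd_sum w k = (\<Sum>\<^sub>\<infinity>d\<in>{0<..}. real d powr - w * real (gcd d k) powr (1 - w))"

lemma gcd_powr_le_1:
  assumes "w > 1" and "k > 0"
  shows "real (gcd d k) powr (1 - w) \<le> 1"
proof -
  have "1 \<le> gcd d k" using assms(2) by (simp add: Suc_leI)
  then have "real (gcd d k) powr (1 - w) \<le> real (gcd d k) powr 0"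
    using assms by (intro powr_mono) linarith+
  then show ?thesis using assms by simp
qed

lemma has_sum_gcd_sum:
  assumes "w > 1" and "k > 0"
  shows "((\<lambda>d. real d powr - w * real (gcd d k) powr (1 - w)) has_sum gcd_sum w k) {0<..}"
  unfolding gcd_sum_def
  by (intro has_sum_infsum summable_on_comparison_test[OF has_sum_imp_summable[OF has_sum_zeta_real[OF assms(1)]]])
    (use assms gcd_powr_le_1[OF assms] in \<open>auto simp: mult_left_le\<close>)

lemma gcd_sum_le:
  assumes "w > 1" and "k > 0"
  shows "gcd_sum w k \<le> zeta_real w"
  using has_sum_gcd_sum[OF assms] has_sum_zeta_real[OF assms(1)]
  by (rule has_sum_mono) (use gcd_powr_le_1[OF assms] in \<open>auto simp: mult_left_le\<close>)

text \<open>With \<open>d = u * e\<close> and \<open>u = gcd d k\<close> the weight becomes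
  \<open>u powr (1 - 2 * w)\<close> times \<open>e powr - w\<close>. For \<open>w = 2 m\<close> the
  first factor is the source of zeta at \<open>s + 4 m - 1\<close>.\<close>

lemma gcd_sum_eq_dirichlet_conv:
  assumes "w > 1" and "k > 0"
  shows "gcd_sum w k = dirichlet_conv (\<lambda>u. real u powr (1 - 2 * w)) (coprime_zeta w) k"
proof -
  have "((\<lambda>((u, v), e). real (u * e) powr - w * real (gcd (u * e) k) powr (1 - w)) has_sum gcd_sum w k)
      (SIGMA (u, v):{(u, v). u * v = k}. {e. e > 0 \<and> coprime e v})"
    using has_sum_gcd_sum[OF assms] by (subst has_sum_split_gcd[OF assms(2)])
  also have "?this \<longleftrightarrow> ((\<lambda>((u, v), e). real u powr (1 - 2 * w) * real e powr - w) has_sum gcd_sum w k)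
      (SIGMA (u, v):{(u, v). u * v = k}. {e. e > 0 \<and> coprime e v})"
  proof (rule has_sum_cong)
    fix x assume "x \<in> (SIGMA (u, v):{(u, v). u * v = k}. {e. e > 0 \<and> coprime e v})"
    then obtain u v e where x: "x = ((u, v), e)" "u * v = k" "e > 0" "coprime e v" by auto
    then have "gcd (u * e) k = u" by (auto simp: gcd_mult_distrib_nat[symmetric])
    then show "(\<lambda>((u, v), e). real (u * e) powr - w * real (gcd (u * e) k) powr (1 - w)) x
      = (\<lambda>((u, v), e). real u powr (1 - 2 * w) * real e powr - w) x"
      using x by (simp add: powr_mult powr_add[symmetric] algebra_simps)
  qed
  finally have "((\<lambda>(u, v). real u powr (1 - 2 * w) * coprime_zeta w v) has_sum gcd_sum w k) {(u, v). u * v = k}"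
    by (rule has_sum_SigmaD) (auto intro!: has_sum_cmult_right has_sum_coprime_zeta assms)
  from has_sum_unique[OF this has_sum_finite[OF finite_factorisations[OF assms(2)]]]
  show ?thesis by (simp add: dirichlet_conv_def)
qed

section \<open>Counting solutions of linear congruences\<close>

lemma card_residue_class:
  fixes b :: int
  assumes "m > 0"
  shows "card {h \<in> {1..int (g * m)}. int m dvd h - b} = g"
proof -
  \<comment> \<open>The range starts at 1, so the shift by one makes \<open>c + 1\<close> the
    representative of \<open>b\<close> in \<open>{1..m}\<close>.\<close>
  define c where "c = (b - 1) mod int m"
  have c: "0 \<le> c" "c < int m" using assms by (simp_all add: c_def)
  have "bij_betw (\<lambda>i. c + 1 + int i * int m) {..<g} {h \<in> {1..int (g * m)}. int m dvd h - b}"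
  proof (rule bij_betw_byWitness[where f' = "\<lambda>h. nat ((h - 1) div int m)"])
    have dc: "int m dvd c - (b - 1)" unfolding c_def by (simp add: mod_eq_dvd_iff[symmetric])
    show "(\<lambda>i. c + 1 + int i * int m) ` {..<g} \<subseteq> {h \<in> {1..int (g * m)}. int m dvd h - b}"
    proof clarsimp
      fix i assume "i < g"
      then have "(int i + 1) * int m \<le> int g * int m" by (intro mult_right_mono) auto
      then have "c + 1 + int i * int m \<le> int g * int m" using c by (simp add: algebra_simps)
      moreover have "int m dvd (c - (b - 1)) + int i * int m" using dc by simp
      ultimately show "0 \<le> c + int i * int m \<and> c + 1 + int i * int m \<le> int g * int m \<and> int m dvd c + 1 + int i * int m - b"
        using c by (simp add: algebra_simps)
    qed
    show "\<forall>i\<in>{..<g}. nat ((c + 1 + int i * int m - 1) div int m) = i" using c assms by simp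
    have mod: "(h - 1) mod int m = c" if "int m dvd h - b" for h
      using that by (simp add: c_def mod_eq_dvd_iff)
    show "\<forall>h\<in>{h \<in> {1..int (g * m)}. int m dvd h - b}. c + 1 + int (nat ((h - 1) div int m)) * int m = h"
    proof clarify
      fix h assume h: "h \<in> {1..int (g * m)}" "int m dvd h - b"
      then have "0 \<le> (h - 1) div int m" using assms by (simp add: pos_imp_zdiv_nonneg_iff)
      then show "c + 1 + int (nat ((h - 1) div int m)) * int m = h"
        using mod[OF h(2)] div_mult_mod_eq[of "h - 1" "int m"] by simp
    qed
    show "(\<lambda>h. nat ((h - 1) div int m)) ` {h \<in> {1..int (g * m)}. int m dvd h - b} \<subseteq> {..<g}"
    proof clarsimp
      fix h assume h: "1 \<le> h" "h \<le> int g * int m"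
      have "(h - 1) div int m * int m \<le> h - 1" 
      proof -
        have "0 \<le> (h - 1) mod int m" using assms by simp
        then show ?thesis using div_mult_mod_eq[of "h - 1" "int m"] by linarith
      qed
      then have "(h - 1) div int m * int m < int g * int m" using h by simp
      then have "(h - 1) div int m < int g" using assms by (simp add: mult_less_cancel_right)
      then show "nat ((h - 1) div int m) < g" using h assms by (simp add: nat_less_iff pos_imp_zdiv_nonneg_iff)
    qed
  qed
  then show ?thesis by (simp add: bij_betw_same_card[symmetric])
qed

text \<open>After division by \<open>g = gcd d k\<close> the coefficient \<open>d'\<close> is
  invertible modulo \<open>m = k / g\<close>, so the solutions form one class modulo
  \<open>m\<close>, which meets \<open>{1..k}\<close> exactly \<open>g\<close> times.\<close>

lemma card_linear_congruence:
  fixes r :: int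
  assumes "k > 0"
  shows "card {h \<in> {1..k}. int k dvd int h * int d - r} = (if int (gcd d k) dvd r then gcd d k else 0)"
proof (cases "int (gcd d k) dvd r")
  case False
  have "\<not> int k dvd int h * int d - r" for h
  proof
    assume "int k dvd int h * int d - r"
    then have "int (gcd d k) dvd int h * int d - r" by (meson dvd_trans gcd_dvd2 int_dvd_int_iff)
    moreover have "int (gcd d k) dvd int h * int d" by simp
    ultimately have "int (gcd d k) dvd int h * int d - (int h * int d - r)" by (rule dvd_diff[rotated])
    with False show False by simp
  qed
  then show ?thesis using False by simp
next
  case True
  define g where "g = gcd d k"
  define m where "m = k div g"
  define d' where "d' = d div g"
  have g0: "g > 0" using assms by (simp add: g_def)
  have k: "k = g * m" and d: "d = g * d'" by (simp_all add: m_def d'_def g_def)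
  have m0: "m > 0" using assms k by (cases m) auto
  obtain r' where r: "r = int g * r'" using True by (auto simp: g_def)
  have "coprime d' m" unfolding d'_def m_def g_def using assms by (intro div_gcd_coprime) auto
  then have "coprime (int d') (int m)" by simp
  then obtain u v where uv: "u * int d' + v * int m = 1"
    using bezout_int[of "int d'" "int m"] by (auto simp: coprime_iff_gcd_eq_1)
  have iff: "int k dvd h * int d - r \<longleftrightarrow> int m dvd h - u * r'" for h
  proof -
    have "h * int d - r = int g * (h * int d' - r')" by (simp add: d r algebra_simps)
    then have "int k dvd h * int d - r \<longleftrightarrow> int m dvd h * int d' - r'"
      using g0 by (simp add: k)
    also have "\<dots> \<longleftrightarrow> int m dvd h - u * r'"
    proof
      assume "int m dvd h * int d' - r'"
      then have "int m dvd u * (h * int d' - r') + int m * (h * v)" by simp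
      also have "u * (h * int d' - r') + int m * (h * v) = h * (u * int d' + v * int m) - u * r'"
        by (simp add: algebra_simps)
      finally show "int m dvd h - u * r'" by (simp add: uv)
    next
      assume "int m dvd h - u * r'"
      then have "int m dvd int d' * (h - u * r') - int m * (v * r')" by simp
      also have "int d' * (h - u * r') - int m * (v * r') = h * int d' - r' * (u * int d' + v * int m)"
        by (simp add: algebra_simps)
      finally show "int m dvd h * int d' - r'" by (simp add: uv)
    qed
    finally show ?thesis .
  qed
  have "bij_betw int {h \<in> {1..k}. int k dvd int h * int d - r} {h \<in> {1..int (g * m)}. int m dvd h - u * r'}"
    by (rule bij_betw_byWitness[where f' = nat]) (auto simp: iff, auto simp: k nat_le_iff simp flip: of_nat_mult)
  from bij_betw_same_card[OF this] have "card {h \<in> {1..k}. int k dvd int h * int d - r} = g"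
    by (simp only: card_residue_class[OF m0])
  then show ?thesis using True by (simp add: g_def)
qed

section \<open>Sums over approximation pairs\<close>

text \<open>
  A pair \<open>(d, r)\<close> stands for the rational approximation \<open>h / k = c / d + r / (k d)\<close> with
  \<open>c = (h d - r) / k\<close>; it is primitive when \<open>c / d\<close> is in lowest terms.
\<close>
definition approx_pairs :: "nat \<Rightarrow> nat \<Rightarrow> (nat \<times> int) set" where
  "approx_pairs h k = {(d, r). d > 0 \<and> r \<noteq> 0 \<and> int k dvd int h * int d - r}"

definition primitive_pairs :: "nat \<Rightarrow> nat \<Rightarrow> (nat \<times> int) set" where
  "primitive_pairs h k = {(d, r) \<in> approx_pairs h k. coprime ((int h * int d - r) div int k) (int d)}"

text \<open>As \<open>h / k - c / d = r / (k d)\<close>, this is \<open>k d^2\<close> times the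
  distance of the two fractions, the natural measure of a rational approximation. It is also
  \<open>k / 12\<close> divided by the absolute value of the main term.\<close>

definition pair_size :: "nat \<times> int \<Rightarrow> real" where
  "pair_size p = real (fst p) * \<bar>of_int (snd p)\<bar>"

lemma has_sum_int_powr:
  assumes "w > 1"
  shows "((\<lambda>r. \<bar>real_of_int r\<bar> powr - w) has_sum (2 * zeta_real w)) {r. r \<noteq> 0}"
proof -
  have "bij_betw int {0<..} {0<..}" by (rule bij_betw_byWitness[where f' = nat]) auto
  then have 1: "((\<lambda>r. \<bar>real_of_int r\<bar> powr - w) has_sum zeta_real w) {0<..}"
    using has_sum_reindex_bij_betw[of int "{0<..}" "{0<..}" "\<lambda>r. \<bar>real_of_int r\<bar> powr - w" "zeta_real w"]
      has_sum_zeta_real[OF assms] by simp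
  have "bij_betw uminus {0<..} {..<0::int}" by (rule bij_betw_byWitness[where f' = uminus]) auto
  then have 2: "((\<lambda>r. \<bar>real_of_int r\<bar> powr - w) has_sum zeta_real w) {..<0}"
    using has_sum_reindex_bij_betw[of uminus "{0<..}" "{..<0}" "\<lambda>r. \<bar>real_of_int r\<bar> powr - w" "zeta_real w"] 1
    by simp
  have "((\<lambda>r. \<bar>real_of_int r\<bar> powr - w) has_sum (zeta_real w + zeta_real w)) ({0<..} \<union> {..<0})"
    by (rule has_sum_Un_disjoint[OF 1 2]) auto
  moreover have "{0<..} \<union> {..<0} = {r::int. r \<noteq> 0}" by auto
  ultimately show ?thesis by simp
qed

lemma has_sum_int_multiples_powr:
  assumes "w > 1" and "g > 0"
  shows "((\<lambda>r. \<bar>real_of_int r\<bar> powr - w) has_sum (real g powr - w * (2 * zeta_real w))) {r. r \<noteq> 0 \<and> int g dvd r}"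
proof -
  have "bij_betw (\<lambda>r. int g * r) {r. r \<noteq> 0} {r. r \<noteq> 0 \<and> int g dvd r}"
    by (rule bij_betw_byWitness[where f' = "\<lambda>r. r div int g"]) (use assms in auto)
  moreover have "((\<lambda>r. \<bar>real_of_int (int g * r)\<bar> powr - w) has_sum (real g powr - w * (2 * zeta_real w))) {r. r \<noteq> 0}"
    using has_sum_cmult_right[OF has_sum_int_powr[OF assms(1)], of "real g powr - w"]
    by (simp add: abs_mult powr_mult)
  ultimately show ?thesis by (rule iffD1[OF has_sum_reindex_bij_betw])
qed

lemma has_sum_approx_pairs_Sigma:
  assumes "w > 1" and "k > 0"
  shows "((\<lambda>(h, p). pair_size p powr - w) has_sum (2 * zeta_real w * gcd_sum w k)) (SIGMA h:{1..k}. approx_pairs h k)"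
proof -
  \<comment> \<open>The same triples with \<open>h\<close> innermost, so that \<open>h\<close> is
    merely counted by \<open>card_linear_congruence\<close>.\<close>
  define V where "V = (SIGMA d:{0<..}. SIGMA r:{r. r \<noteq> 0 \<and> int (gcd d k) dvd r}. {h \<in> {1..k}. int k dvd int h * int d - r})"
  have "((\<lambda>(d, r, h). pair_size (d, r) powr - w) has_sum (2 * zeta_real w * gcd_sum w k)) V"
    unfolding V_def
  proof (rule has_sum_Sigma_nonneg)
    show "((\<lambda>d. 2 * zeta_real w * (real d powr - w * real (gcd d k) powr (1 - w))) has_sum (2 * zeta_real w * gcd_sum w k)) {0<..}"
      by (intro has_sum_cmult_right has_sum_gcd_sum assms)
    fix d :: nat assume "d \<in> {0<..}"
    define g where "g = gcd d k"
    have g: "g > 0" using assms by (simp add: g_def)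
    show "((\<lambda>y. case (d, y) of (d, r, h) \<Rightarrow> pair_size (d, r) powr - w) has_sum (2 * zeta_real w * (real d powr - w * real (gcd d k) powr (1 - w))))
      (SIGMA r:{r. r \<noteq> 0 \<and> int (gcd d k) dvd r}. {h \<in> {1..k}. int k dvd int h * int d - r})"
    proof (rule has_sum_Sigma_nonneg)
      have "real g powr (1 - w) = real g * real g powr - w" using g by (simp add: powr_diff powr_minus_divide)
      then have eq: "2 * zeta_real w * (real d powr - w * real g powr (1 - w)) = (real d powr - w * real g) * (real g powr - w * (2 * zeta_real w))"
        by simp
      show "((\<lambda>r. real d powr - w * real g * \<bar>real_of_int r\<bar> powr - w) has_sum (2 * zeta_real w * (real d powr - w * real (gcd d k) powr (1 - w)))) {r. r \<noteq> 0 \<and> int (gcd d k) dvd r}"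
        unfolding g_def[symmetric] unfolding eq by (intro has_sum_cmult_right has_sum_int_multiples_powr assms g)
      fix r assume r: "r \<in> {r. r \<noteq> 0 \<and> int (gcd d k) dvd r}"
      have "card {h \<in> {1..k}. int k dvd int h * int d - r} = g"
        using r card_linear_congruence[OF assms(2), of d r] by (simp add: g_def)
      then show "((\<lambda>y. case (d, r, y) of (d, r, h) \<Rightarrow> pair_size (d, r) powr - w) has_sum (real d powr - w * real g * \<bar>real_of_int r\<bar> powr - w)) {h \<in> {1..k}. int k dvd int h * int d - r}"
        by (intro has_sum_finiteI) (auto simp: pair_size_def powr_mult)
    qed auto
  qed auto
  also have "?this \<longleftrightarrow> ((\<lambda>(h, p). pair_size p powr - w) has_sum (2 * zeta_real w * gcd_sum w k)) (SIGMA h:{1..k}. approx_pairs h k)"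
  proof (rule has_sum_reindex_bij_witness[of _ "\<lambda>(h, d, r). (d, r, h)" "\<lambda>(d, r, h). (h, d, r)"])
    fix b assume "b \<in> (SIGMA h:{1..k}. approx_pairs h k)"
    then obtain h d r where b: "b = (h, d, r)" "h \<in> {1..k}" "d > 0" "r \<noteq> 0" "int k dvd int h * int d - r"
      by (auto simp: approx_pairs_def)
    then have "card {h \<in> {1..k}. int k dvd int h * int d - r} \<noteq> 0" by auto
    then have "int (gcd d k) dvd r" using card_linear_congruence[OF assms(2), of d r] by metis
    then show "(\<lambda>(h, d, r). (d, r, h)) b \<in> V" using b by (auto simp: V_def)
  qed (auto simp: V_def approx_pairs_def)
  finally show ?thesis .
qed

definition approx_sum :: "real \<Rightarrow> nat \<Rightarrow> nat \<Rightarrow> real" where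
  "approx_sum w h k = (\<Sum>\<^sub>\<infinity>p\<in>approx_pairs h k. pair_size p powr - w)"

definition primitive_sum :: "real \<Rightarrow> nat \<Rightarrow> nat \<Rightarrow> real" where
  "primitive_sum w h k = (\<Sum>\<^sub>\<infinity>p\<in>primitive_pairs h k. pair_size p powr - w)"

lemma has_sum_approx_sum:
  assumes "w > 1" and "k > 0" and "h \<in> {1..k}"
  shows "((\<lambda>p. pair_size p powr - w) has_sum approx_sum w h k) (approx_pairs h k)"
  unfolding approx_sum_def
  by (intro has_sum_infsum summable_on_SigmaD1[OF has_sum_imp_summable[OF has_sum_approx_pairs_Sigma[OF assms(1,2)]] assms(3)])

lemma has_sum_primitive_sum:
  assumes "w > 1" and "k > 0" and "h \<in> {1..k}"
  shows "((\<lambda>p. pair_size p powr - w) has_sum primitive_sum w h k) (primitive_pairs h k)"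
  unfolding primitive_sum_def
  by (intro has_sum_infsum summable_on_subset[OF has_sum_imp_summable[OF has_sum_approx_sum[OF assms]]])
    (auto simp: primitive_pairs_def)

lemma sum_approx_sum:
  assumes "w > 1" and "k > 0"
  shows "(\<Sum>h=1..k. approx_sum w h k) = 2 * zeta_real w * gcd_sum w k"
proof -
  have "((\<lambda>h. approx_sum w h k) has_sum (2 * zeta_real w * gcd_sum w k)) {1..k}"
    by (rule has_sum_SigmaD[OF has_sum_approx_pairs_Sigma[OF assms]])
      (use has_sum_approx_sum[OF assms] in auto)
  from has_sum_unique[OF this has_sum_finite] show ?thesis by simp
qed

lemma sum_primitive_sum_le:
  assumes "w > 1" and "k > 0"
  shows "(\<Sum>h | h \<in> {1..k} \<and> coprime h k. primitive_sum w h k) \<le> 2 * (zeta_real w)^2"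
proof -
  have le: "primitive_sum w h k \<le> approx_sum w h k" if "h \<in> {1..k}" for h
    using has_sum_primitive_sum[OF assms that] has_sum_approx_sum[OF assms that]
    by (rule has_sum_mono2) (auto simp: primitive_pairs_def)
  have nn: "0 \<le> approx_sum w h k" for h unfolding approx_sum_def by (rule infsum_nonneg) auto
  have "(\<Sum>h | h \<in> {1..k} \<and> coprime h k. primitive_sum w h k) \<le> (\<Sum>h | h \<in> {1..k} \<and> coprime h k. approx_sum w h k)"
    by (intro sum_mono le) auto
  also have "\<dots> \<le> (\<Sum>h=1..k. approx_sum w h k)"
    by (intro sum_mono2 nn) auto
  also have "\<dots> \<le> 2 * zeta_real w * zeta_real w"
    unfolding sum_approx_sum[OF assms]
    using gcd_sum_le[OF assms] zeta_real_pos[OF assms(1)] by (intro mult_left_mono) auto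
  finally show ?thesis by (simp add: power2_eq_square)
qed

text \<open>A congruence for \<open>u * h\<close> modulo \<open>u * k\<close> forces
  \<open>u\<close> to divide \<open>r\<close>, so the pairs correspond by scaling \<open>r\<close>
  alone. This strips the common factor of numerator and modulus.\<close>

lemma approx_sum_mult:
  assumes "u > 0"
  shows "approx_sum w (u * h) (u * k) = real u powr - w * approx_sum w h k"
proof -
  have "approx_sum w (u * h) (u * k) = (\<Sum>\<^sub>\<infinity>p\<in>approx_pairs h k. real u powr - w * pair_size p powr - w)"
    unfolding approx_sum_def
  proof (rule infsum_reindex_bij_witness[of _ "\<lambda>(d, r). (d, int u * r)" "\<lambda>(d, r). (d, r div int u)"])
    fix a assume "a \<in> approx_pairs (u * h) (u * k)"
    then obtain d r where a: "a = (d, r)" "d > 0" "r \<noteq> 0" "int u * int k dvd int u * int h * int d - r"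
      by (auto simp: approx_pairs_def)
    then have "int u dvd int u * int h * int d - r" by (metis dvd_mult_left)
    then have "int u dvd int u * (int h * int d) - (int u * int h * int d - r)"
      by (rule dvd_diff[OF dvd_triv_left])
    then obtain r' where r: "r = int u * r'" by auto
    have "int u * int h * int d - r = int u * (int h * int d - r')" by (simp add: r algebra_simps)
    then have dv: "int k dvd int h * int d - r'" using a assms by simp
    show "(\<lambda>(d, r). (d, int u * r)) ((\<lambda>(d, r). (d, r div int u)) a) = a"
      using a r assms by simp
    show "(\<lambda>(d, r). (d, r div int u)) a \<in> approx_pairs h k"
      using a r dv assms by (auto simp: approx_pairs_def)
    show "real u powr - w * pair_size ((\<lambda>(d, r). (d, r div int u)) a) powr - w = pair_size a powr - w"
      using a r assms by (simp add: pair_size_def abs_mult powr_mult)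
  next
    fix b assume "b \<in> approx_pairs h k"
    then obtain d r where b: "b = (d, r)" "d > 0" "r \<noteq> 0" "int k dvd int h * int d - r"
      by (auto simp: approx_pairs_def)
    have "int u * int h * int d - int u * r = int u * (int h * int d - r)" by (simp add: algebra_simps)
    then show "(\<lambda>(d, r). (d, int u * r)) b \<in> approx_pairs (u * h) (u * k)"
      using b assms by (auto simp: approx_pairs_def)
    show "(\<lambda>(d, r). (d, r div int u)) ((\<lambda>(d, r). (d, int u * r)) b) = b" using b assms by simp
  qed
  also have "\<dots> = real u powr - w * approx_sum w h k"
    unfolding approx_sum_def by (rule infsum_cmult_right')
  finally show ?thesis .
qed

lemma sum_split_gcd:
  fixes f :: "nat \<Rightarrow> real"
  assumes "k > 0"
  shows "(\<Sum>h=1..k. f h) = (\<Sum>(u, v) | u * v = k. \<Sum>h | h \<in> {1..v} \<and> coprime h v. f (u * h))"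
proof -
  have "(\<Sum>h=1..k. f h) = (\<Sum>((u, v), h)\<in>(SIGMA (u, v):{(u, v). u * v = k}. {h. h \<in> {1..v} \<and> coprime h v}). f (u * h))"
  proof (rule sum.reindex_bij_witness[of _ "\<lambda>((u, v), e). u * e" "\<lambda>d. ((gcd d k, k div gcd d k), d div gcd d k)"])
    fix x assume "x \<in> (SIGMA (u, v):{(u, v). u * v = k}. {h. h \<in> {1..v} \<and> coprime h v})"
    then obtain u v e where x: "x = ((u, v), e)" "u * v = k" "e \<in> {1..v}" "coprime e v" by auto
    then have "gcd (u * e) k = u" by (auto simp: gcd_mult_distrib_nat[symmetric])
    then show "(\<lambda>d. ((gcd d k, k div gcd d k), d div gcd d k)) ((\<lambda>((u, v), e). u * e) x) = x"
      using x assms by auto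
    show "(\<lambda>((u, v), e). u * e) x \<in> {1..k}" using x assms by (auto simp: Suc_le_eq)
  next
    fix d assume d: "d \<in> {1..k}"
    then have "coprime (d div gcd d k) (k div gcd d k)" by (intro div_gcd_coprime) auto
    then show "((gcd d k, k div gcd d k), d div gcd d k) \<in> (SIGMA (u, v):{(u, v). u * v = k}. {h. h \<in> {1..v} \<and> coprime h v})"
      using d assms by (auto simp: div_greater_zero_iff gcd_le1_nat Suc_le_eq div_le_mono)
  qed auto
  also have "\<dots> = (\<Sum>(u, v) | u * v = k. \<Sum>h | h \<in> {1..v} \<and> coprime h v. f (u * h))"
    using assms by (subst sum.Sigma[symmetric]) (auto simp: case_prod_unfold intro!: finite_factorisations[unfolded case_prod_unfold])
  finally show ?thesis .
qed

lemma sum_approx_sum_eq_dirichlet_conv: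
  assumes "k > 0"
  shows "(\<Sum>h=1..k. approx_sum w h k)
    = dirichlet_conv (\<lambda>u. real u powr - w) (\<lambda>v. \<Sum>h | h \<in> {1..v} \<and> coprime h v. approx_sum w h v) k"
  unfolding sum_split_gcd[OF assms] dirichlet_conv_def
  using assms by (intro sum.cong) (auto simp: approx_sum_mult sum_distrib_left)

text \<open>Each pair is a unique multiple of a primitive one, the multiplier being
  \<open>v = gcd c d\<close>. Both \<open>d\<close> and \<open>r\<close> are scaled, so the size
  grows by \<open>v^2\<close>, which explains zeta at \<open>2 * w\<close>.\<close>

lemma approx_sum_eq_primitive_sum:
  assumes "w > 1" and "k > 0" and "h \<in> {1..k}"
  shows "approx_sum w h k = zeta_real (2 * w) * primitive_sum w h k"
proof -
  have "((\<lambda>(v, p). real v powr (- (2 * w)) * pair_size p powr - w) has_sum approx_sum w h k) ({0::nat<..} \<times> primitive_pairs h k)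
    \<longleftrightarrow> ((\<lambda>p. pair_size p powr - w) has_sum approx_sum w h k) (approx_pairs h k)"
  proof (rule has_sum_reindex_bij_witness[of _
        "\<lambda>(d, r). let v = nat (gcd ((int h * int d - r) div int k) (int d)) in (v, d div v, r div int v)"
        "\<lambda>(v, d, r). (v * d, int v * r)"])
    fix x :: "nat \<times> nat \<times> int" assume "x \<in> {0<..} \<times> primitive_pairs h k"
    then obtain v d r where x: "x = (v, d, r)" "v > 0" "d > 0" "r \<noteq> 0" "int k dvd int h * int d - r"
      "coprime ((int h * int d - r) div int k) (int d)"
      by (auto simp: primitive_pairs_def approx_pairs_def)
    then obtain c where c: "int h * int d - r = int k * c" by auto
    have cd: "coprime c (int d)" using x c assms by simp
    have "int h * int (v * d) - int v * r = int v * (int h * int d - r)" by (simp add: algebra_simps)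
    then have e: "int h * int (v * d) - int v * r = int k * (int v * c)" unfolding c by simp
    \<comment> \<open>Primitivity enters here: it allows the multiplier to be recovered from the
      scaled pair.\<close>
    have "gcd (int v * c) (int v * int d) = int v" using cd by (simp add: gcd_mult_left)
    then show "(\<lambda>(d, r). let v = nat (gcd ((int h * int d - r) div int k) (int d)) in (v, d div v, r div int v))
      ((\<lambda>(v, d, r). (v * d, int v * r)) x) = x"
      using x e assms by (simp add: Let_def del: of_nat_mult) simp
    show "(\<lambda>(v, d, r). (v * d, int v * r)) x \<in> approx_pairs h k"
      using x e by (simp add: approx_pairs_def del: of_nat_mult)
    show "pair_size ((\<lambda>(v, d, r). (v * d, int v * r)) x) powr - w = (\<lambda>(v, p). real v powr (- (2 * w)) * pair_size p powr - w) x"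
      using x by (simp add: pair_size_def abs_mult powr_mult powr_add[symmetric] algebra_simps)
  next
    fix b assume "b \<in> approx_pairs h k"
    then obtain d r where b: "b = (d, r)" "d > 0" "r \<noteq> 0" "int k dvd int h * int d - r"
      by (auto simp: approx_pairs_def)
    then obtain c where c: "int h * int d - r = int k * c" by auto
    define v where "v = nat (gcd c (int d))"
    have v: "int v = gcd c (int d)" "v > 0" using b by (auto simp: v_def)
    have "int v dvd int d" by (simp add: v)
    then obtain d' where d': "d = v * d'" by (auto simp: int_dvd_int_iff)
    have "int v dvd c" by (simp add: v)
    then obtain c' where c': "c = int v * c'" by auto
    have r: "r = int v * (int h * int d' - int k * c')" using c by (simp add: d' c' algebra_simps)
    have cop: "coprime c' (int d')"
    proof -
      have "int v * gcd c' (int d') = gcd (int v * c') (int v * int d')" by (simp add: gcd_mult_left)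
      also have "\<dots> = int v" using v(1) by (simp add: c' d')
      finally show ?thesis using v(2) by (simp add: coprime_iff_gcd_eq_1)
    qed
    have x: "(\<lambda>(d, r). let v = nat (gcd ((int h * int d - r) div int k) (int d)) in (v, d div v, r div int v)) b
      = (v, d', int h * int d' - int k * c')"
    proof -
      have "(int h * int d - r) div int k = c" using c assms by simp
      then have "nat (gcd ((int h * int d - r) div int k) (int d)) = v" by (simp add: v_def)
      then have "(\<lambda>(d, r). let v = nat (gcd ((int h * int d - r) div int k) (int d)) in (v, d div v, r div int v)) b
        = (v, d div v, r div int v)" using b(1) by (simp only: prod.case Let_def)
      also have "\<dots> = (v, d', int h * int d' - int k * c')" using v(2) by (simp add: d' r)
      finally show ?thesis .
    qed
    show "(\<lambda>(v, d, r). (v * d, int v * r)) ((\<lambda>(d, r). let v = nat (gcd ((int h * int d - r) div int k) (int d)) in (v, d div v, r div int v)) b) = b"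
      unfolding x using b(1) d' r by simp
    show "(\<lambda>(d, r). let v = nat (gcd ((int h * int d - r) div int k) (int d)) in (v, d div v, r div int v)) b \<in> {0<..} \<times> primitive_pairs h k"
      unfolding x using v cop b d' r assms by (auto simp: primitive_pairs_def approx_pairs_def)
  qed auto
  then have "((\<lambda>(v, p). real v powr (- (2 * w)) * pair_size p powr - w) has_sum approx_sum w h k) ({0::nat<..} \<times> primitive_pairs h k)"
    using has_sum_approx_sum[OF assms] by simp
  then have "((\<lambda>v. real v powr (- (2 * w)) * primitive_sum w h k) has_sum approx_sum w h k) {0<..}"
    by (rule has_sum_SigmaD) (auto intro!: has_sum_cmult_right has_sum_primitive_sum[OF assms])
  moreover have "((\<lambda>v. real v powr (- (2 * w)) * primitive_sum w h k) has_sum zeta_real (2 * w) * primitive_sum w h k) {0<..}"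
    using assms by (intro has_sum_cmult_left has_sum_zeta_real) auto
  ultimately show ?thesis by (rule has_sum_unique)
qed

text \<open>For \<open>w = 2 m\<close> and \<open>B\<close> the sum over \<open>h\<close>, this
  reads, in terms of Dirichlet series, \<open>zeta(4m) zeta(s+2m)^2 B(s) = 2 zeta(2m)^2 zeta(s+4m-1)
  zeta(s)\<close>, the equation defining \<open>f\<close>. One factor \<open>a\<close> collects the
  \<open>h\<close> not coprime to the modulus; the other turns \<open>coprime_zeta\<close> into a
  constant.\<close>

lemma dirichlet_conv_primitive_sum:
  assumes "w > 1" and "k > 0"
  defines "a \<equiv> \<lambda>u. real u powr - w"
  shows "zeta_real (2 * w) * dirichlet_conv a (dirichlet_conv a (\<lambda>v. \<Sum>h | h \<in> {1..v} \<and> coprime h v. primitive_sum w h v)) k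
    = 2 * (zeta_real w)^2 * dirichlet_conv (\<lambda>u. real u powr (1 - 2 * w)) (\<lambda>_. 1) k"
proof -
  define B where "B = (\<lambda>v. \<Sum>h | h \<in> {1..v} \<and> coprime h v. primitive_sum w h v)"
  define p where "p = (\<lambda>u. real u powr (1 - 2 * w))"
  have "zeta_real (2 * w) * dirichlet_conv a B v = 2 * zeta_real w * dirichlet_conv p (coprime_zeta w) v" if "v > 0" for v
  proof -
    have "zeta_real (2 * w) * dirichlet_conv a B v = dirichlet_conv a (\<lambda>v. \<Sum>h | h \<in> {1..v} \<and> coprime h v. approx_sum w h v) v"
      unfolding dirichlet_conv_cmult_right[symmetric] B_def using assms that
      by (intro dirichlet_conv_cong) (auto simp: sum_distrib_left approx_sum_eq_primitive_sum intro!: sum.cong)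
    also have "\<dots> = 2 * zeta_real w * gcd_sum w v"
      unfolding a_def sum_approx_sum_eq_dirichlet_conv[OF that, symmetric] by (rule sum_approx_sum[OF assms(1) that])
    finally show ?thesis using gcd_sum_eq_dirichlet_conv[OF assms(1) that] by (simp add: p_def)
  qed
  then have "dirichlet_conv a (\<lambda>v. zeta_real (2 * w) * dirichlet_conv a B v) k
    = dirichlet_conv a (\<lambda>v. 2 * zeta_real w * dirichlet_conv p (coprime_zeta w) v) k"
    using assms(2) by (intro dirichlet_conv_cong) auto
  then have "zeta_real (2 * w) * dirichlet_conv a (dirichlet_conv a B) k
    = dirichlet_conv a (\<lambda>v. 2 * zeta_real w * dirichlet_conv p (coprime_zeta w) v) k"
    by (simp only: dirichlet_conv_cmult_right)
  also have "\<dots> = 2 * zeta_real w * dirichlet_conv (dirichlet_conv a p) (coprime_zeta w) k"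
    using assms by (simp add: dirichlet_conv_cmult_right dirichlet_conv_assoc)
  also have "dirichlet_conv a p = dirichlet_conv p a" by (rule ext) (rule dirichlet_conv_commute)
  also have "dirichlet_conv (dirichlet_conv p a) (coprime_zeta w) k = dirichlet_conv p (dirichlet_conv a (coprime_zeta w)) k"
    using assms by (intro dirichlet_conv_assoc)
  also have "\<dots> = dirichlet_conv p (\<lambda>_. zeta_real w * 1) k"
    unfolding a_def using assms by (intro dirichlet_conv_cong) (auto simp: dirichlet_conv_powr_coprime_zeta)
  also have "\<dots> = zeta_real w * dirichlet_conv p (\<lambda>_. 1) k" by (rule dirichlet_conv_cmult_right)
  finally show ?thesis by (simp add: B_def p_def power2_eq_square)
qed

section \<open>Dirichlet series\<close>

lemma has_sum_dirichlet_conv: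
  assumes F: "((\<lambda>n. F n * real n powr - x) has_sum \<alpha>) {0<..}"
    and G: "((\<lambda>n. G n * real n powr - x) has_sum \<beta>) {0<..}"
  shows "((\<lambda>n. dirichlet_conv F G n * real n powr - x) has_sum \<alpha> * \<beta>) {0<..}"
proof -
  define P where "P = (\<lambda>(i, j). (F i * real i powr - x) * (G j * real j powr - x))"
  have "(\<lambda>n. \<bar>F n * real n powr - x\<bar>) summable_on {0<..}" "(\<lambda>n. \<bar>G n * real n powr - x\<bar>) summable_on {0<..}"
    using summable_on_iff_abs_summable_on_real[THEN iffD1, OF has_sum_imp_summable[OF F]]
      summable_on_iff_abs_summable_on_real[THEN iffD1, OF has_sum_imp_summable[OF G]]
    by (simp_all only: real_norm_def)
  then obtain A B where AB: "((\<lambda>n. \<bar>F n * real n powr - x\<bar>) has_sum A) {0<..}"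
    "((\<lambda>n. \<bar>G n * real n powr - x\<bar>) has_sum B) {0<..}" by (auto simp: summable_on_def)
  have "((\<lambda>p. \<bar>P p\<bar>) has_sum A * B) ({0<..} \<times> {0<..})"
  proof (rule has_sum_Sigma_nonneg)
    show "((\<lambda>i. \<bar>F i * real i powr - x\<bar> * B) has_sum A * B) {0<..}" by (intro has_sum_cmult_left AB)
    show "((\<lambda>j. \<bar>P (i, j)\<bar>) has_sum \<bar>F i * real i powr - x\<bar> * B) {0<..}" for i
      unfolding P_def prod.case abs_mult[of "F i * real i powr - x"] by (intro has_sum_cmult_right AB)
  qed auto
  then have "(\<lambda>p. \<bar>P p\<bar>) summable_on ({0<..} \<times> {0<..})" by (rule has_sum_imp_summable)
  then have "P summable_on ({0<..} \<times> {0<..})"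
    by (subst summable_on_iff_abs_summable_on_real) (simp only: real_norm_def)
  moreover have "((\<lambda>i. F i * real i powr - x * \<beta>) has_sum \<alpha> * \<beta>) {0<..}" by (intro has_sum_cmult_left F)
  ultimately have "(P has_sum \<alpha> * \<beta>) ({0<..} \<times> {0<..})"
    by (intro has_sum_SigmaI[where g = "\<lambda>i. F i * real i powr - x * \<beta>"])
      (auto simp: P_def intro!: has_sum_cmult_right G)
  also have "?this \<longleftrightarrow> ((\<lambda>(n, p). P p) has_sum \<alpha> * \<beta>) (SIGMA n:{0<..}. {(i, j). i * j = n})"
    by (rule has_sum_reindex_bij_witness[of _ snd "\<lambda>(i, j). (i * j, (i, j))"]) auto
  finally show ?thesis
  proof (rule has_sum_SigmaD)
    fix n :: nat assume n: "n \<in> {0<..}"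
    have "dirichlet_conv F G n * real n powr - x = (\<Sum>p | fst p * snd p = n. P p)"
      unfolding dirichlet_conv_def sum_distrib_right
      by (intro sum.cong) (auto simp: P_def powr_mult)
    then show "((\<lambda>y. case (n, y) of (n, p) \<Rightarrow> P p) has_sum dirichlet_conv F G n * real n powr - x) {(i, j). i * j = n}"
      using n finite_factorisations[of n] by (auto simp: case_prod_unfold intro!: has_sum_finiteI)
  qed
qed

text \<open>Once the earlier coefficients vanish, the term at \<open>n\<close> must balance the
  whole tail, but for growing \<open>x\<close> the tail decays faster, at least like
  \<open>(n + 1) powr - x\<close>.\<close>

lemma dirichlet_series_coeff_zero:
  fixes H :: "nat \<Rightarrow> real"
  assumes zero: "\<And>x. x \<ge> x0 \<Longrightarrow> ((\<lambda>n. H n * real n powr - x) has_sum 0) {0<..}" and "n > 0"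
  shows "H n = 0"
  using assms(2)
proof (induction n rule: less_induct)
  case (less n)
  have "(\<lambda>k. H k * real k powr - x0) summable_on {n<..}"
    by (rule summable_on_subset[OF has_sum_imp_summable[OF zero[OF order_refl]]]) (use less.prems in auto)
  then have "(\<lambda>k. \<bar>H k * real k powr - x0\<bar>) summable_on {n<..}"
    by (drule_tac summable_on_iff_abs_summable_on_real[THEN iffD1]) (simp only: real_norm_def)
  then obtain S where S: "((\<lambda>k. \<bar>H k * real k powr - x0\<bar>) has_sum S) {n<..}" by (auto simp: summable_on_def)
  have bound: "\<bar>H n\<bar> * real n powr - x0 \<le> S * (real n / real (n + 1)) ^ t" for t :: nat
  proof -
    \<comment> \<open>Integer steps above \<open>x0\<close>: each \<open>k > n\<close> in the tail
      contributes an extra factor of at most \<open>(n + 1) powr - t\<close>, uniformly over the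
      absolutely convergent tail at \<open>x0\<close>.\<close>
    define x where "x = x0 + real t"
    have x: "x \<ge> x0" by (simp add: x_def)
    define g where "g = (\<lambda>k. H k * real k powr - x)"
    have "(g has_sum 0) {0<..}" unfolding g_def by (rule zero[OF x])
    also have "?this \<longleftrightarrow> (g has_sum 0) (insert n {n<..})"
      by (rule has_sum_cong_neutral) (use less in \<open>auto simp: g_def\<close>)
    finally have g0: "(g has_sum 0) (insert n {n<..})" .
    have "g summable_on {n<..}" by (rule summable_on_subset[OF has_sum_imp_summable[OF g0]]) auto
    then obtain s where s: "(g has_sum s) {n<..}" by (auto simp: summable_on_def)
    then have "(g has_sum (g n + s)) (insert n {n<..})" by (intro has_sum_insert) auto
    with g0 have "g n + s = 0" by (metis has_sum_unique)
    then have "\<bar>g n\<bar> = norm s" by (simp add: real_norm_def)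
    also have "\<dots> \<le> S * real (n + 1) powr - real t"
    proof (rule norm_infsum_le[OF s])
      show "((\<lambda>k. \<bar>H k * real k powr - x0\<bar> * real (n + 1) powr - real t) has_sum S * real (n + 1) powr - real t) {n<..}"
        by (intro has_sum_cmult_left S)
      fix k assume k: "k \<in> {n<..}"
      have "real k powr - x = real k powr - x0 * real k powr - real t"
        by (simp add: x_def powr_add[symmetric])
      moreover have "real k powr - real t \<le> real (n + 1) powr - real t"
        using k by (intro powr_mono2') auto
      ultimately show "norm (g k) \<le> \<bar>H k * real k powr - x0\<bar> * real (n + 1) powr - real t"
        by (simp add: g_def abs_mult mult_left_mono mult.assoc)
    qed
    finally have "\<bar>H n\<bar> * real n powr - x0 * real n powr - real t \<le> S * real (n + 1) powr - real t"
      by (simp add: g_def x_def abs_mult powr_add[symmetric] algebra_simps)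
    then show ?thesis using less.prems
      by (simp add: powr_minus powr_realpow field_simps)
  qed
  have "(\<lambda>t. S * (real n / real (n + 1)) ^ t) \<longlonglongrightarrow> S * 0"
    by (intro tendsto_mult tendsto_const LIMSEQ_power_zero) auto
  then have "\<bar>H n\<bar> * real n powr - x0 \<le> S * 0"
    by (rule LIMSEQ_le_const) (use bound in auto)
  then show ?case using less.prems by (simp add: mult_le_0_iff)
qed

lemma dirichlet_coeff_eq_primitive_sum:
  fixes m :: nat and f :: "nat \<Rightarrow> real"
  assumes "m > 0"
    and "\<And>s :: complex. Re s > 1 \<Longrightarrow>
      (\<lambda>n. of_real (f (Suc n)) / of_nat (Suc n) powr s) sums
        (2 * (zeta (2 * of_nat m) ^ 2 * zeta (s + 4 * of_nat m - 1)
              / (zeta (4 * of_nat m) * zeta (s + 2 * of_nat m) ^ 2)) * zeta s)"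
    and "k > 0"
  shows "f k = (\<Sum>h | h \<in> {1..k} \<and> coprime h k. primitive_sum (2 * real m) h k)"
proof -
  define w where "w = 2 * real m"
  have w: "w > 1" using assms(1) by (simp add: w_def)
  define R where "R = (\<lambda>x. 2 * ((zeta_real w)^2 * zeta_real (x + 2 * w - 1)
    / (zeta_real (2 * w) * (zeta_real (x + w))^2)) * zeta_real x)"
  have ser: "(\<lambda>n. f (Suc n) * real (Suc n) powr - x) sums R x" if x: "x > 1" for x
  proof -
    have z: "zeta (2 * of_nat m) = of_real (zeta_real w)" "zeta (4 * of_nat m) = of_real (zeta_real (2 * w))"
      "zeta (of_real x + 4 * of_nat m - 1) = of_real (zeta_real (x + 2 * w - 1))"
      "zeta (of_real x + 2 * of_nat m) = of_real (zeta_real (x + w))" "zeta (of_real x) = of_real (zeta_real x)"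
      using zeta_of_real[OF w] zeta_of_real[of "2 * w"] zeta_of_real[of "x + 2 * w - 1"]
        zeta_of_real[of "x + w"] zeta_of_real[OF x] w x
      by (simp_all add: w_def)
    have "(\<lambda>n. complex_of_real (f (Suc n) * real (Suc n) powr - x)) sums of_real (R x)"
      using assms(2)[of "of_real x"] x unfolding z
      by (simp add: R_def powr_of_real[symmetric] powr_minus divide_inverse del: of_nat_Suc)
    then show ?thesis by (simp only: sums_of_real_iff)
  qed
  \<comment> \<open>The hypothesis gives convergence only in the order of the integers. Convergence
    at 2 bounds \<open>|f n|\<close> by \<open>C n^2\<close>, so the series converges absolutely
    from 4 on, as unordered sums require.\<close>
  have "(\<lambda>n. f (Suc n) * real (Suc n) powr - 2) \<longlonglongrightarrow> 0"
    by (rule summable_LIMSEQ_zero[OF sums_summable[OF ser]]) simp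
  then have "Bseq (\<lambda>n. f (Suc n) * real (Suc n) powr - 2)"
    by (intro convergent_imp_Bseq convergentI)
  then obtain C where "\<forall>n. norm (f (Suc n) * real (Suc n) powr - 2) \<le> C"
    unfolding Bseq_def by blast
  then have C: "\<bar>f (Suc n) * real (Suc n) powr - 2\<bar> \<le> C" for n
    unfolding real_norm_def by blast
  have f_has_sum: "((\<lambda>n. f n * real n powr - x) has_sum R x) {0<..}" if x: "x \<ge> 4" for x
  proof -
    have "summable (\<lambda>n. C * real (Suc n) powr - 2)"
      using sums_summable[OF zeta_real_sums[of 2]] by (intro summable_mult) (simp add: powr_minus_divide)
    then have "summable (\<lambda>n. norm (f (Suc n) * real (Suc n) powr - x))"
    proof (rule summable_comparison_test'[where N = 0])
      fix n
      have "real (Suc n) powr - x \<le> real (Suc n) powr (- 2 + - 2)" using x by (intro powr_mono) auto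
      then have "\<bar>f (Suc n)\<bar> * real (Suc n) powr - x \<le> \<bar>f (Suc n)\<bar> * real (Suc n) powr - 2 * real (Suc n) powr - 2"
        unfolding powr_add by (simp add: mult_left_mono mult.assoc)
      also have "\<dots> \<le> C * real (Suc n) powr - 2"
        using C[of n] by (intro mult_right_mono) (auto simp: abs_mult)
      finally show "norm (norm (f (Suc n) * real (Suc n) powr - x)) \<le> C * real (Suc n) powr - 2"
        by (simp add: abs_mult)
    qed
    then have "((\<lambda>n. f (Suc n) * real (Suc n) powr - x) has_sum R x) UNIV"
      using ser[of x] x by (intro norm_summable_imp_has_sum) auto
    moreover have "bij_betw Suc UNIV {0<..}" by (rule bij_betw_byWitness[where f' = "\<lambda>n. n - 1"]) auto
    ultimately show ?thesis using has_sum_reindex_bij_betw[of Suc UNIV "{0<..}" "\<lambda>n. f n * real n powr - x" "R x"] by simp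
  qed
  define a where "a = (\<lambda>u. real u powr - w)"
  define p where "p = (\<lambda>u. real u powr (1 - 2 * w))"
  define c where "c = 2 * (zeta_real w)^2 / zeta_real (2 * w)"
  define B where "B = (\<lambda>v. \<Sum>h | h \<in> {1..v} \<and> coprime h v. primitive_sum w h v)"
  have a_has_sum: "((\<lambda>n. a n * real n powr - x) has_sum zeta_real (x + w)) {0<..}" if "x \<ge> 4" for x
    using has_sum_zeta_real[of "x + w"] that w by (simp add: a_def powr_add[symmetric] algebra_simps)
  have p_has_sum: "((\<lambda>n. p n * real n powr - x) has_sum zeta_real (x + 2 * w - 1)) {0<..}" if "x \<ge> 4" for x
    using has_sum_zeta_real[of "x + 2 * w - 1"] that w by (simp add: p_def powr_add[symmetric] algebra_simps)
  have one_has_sum: "((\<lambda>n. 1 * real n powr - x) has_sum zeta_real x) {0<..}" if "x \<ge> 4" for x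
    using has_sum_zeta_real[of x] that by simp
  \<comment> \<open>The denominator \<open>zeta(s + 2m)^2\<close> is moved to the side of
    \<open>f\<close>, so that both sides are products of series with explicit coefficients.\<close>
  have "dirichlet_conv a (dirichlet_conv a f) n - c * dirichlet_conv p (\<lambda>_. 1) n = 0" if "n > 0" for n
  proof (rule dirichlet_series_coeff_zero[of 4, OF _ that])
    fix x :: real assume x: "4 \<le> x"
    have "((\<lambda>n. dirichlet_conv a (dirichlet_conv a f) n * real n powr - x) has_sum zeta_real (x + w) * (zeta_real (x + w) * R x)) {0<..}"
      by (intro has_sum_dirichlet_conv a_has_sum f_has_sum x)
    moreover have "((\<lambda>n. - c * (dirichlet_conv p (\<lambda>_. 1) n * real n powr - x)) has_sum - c * (zeta_real (x + 2 * w - 1) * zeta_real x)) {0<..}"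
      by (intro has_sum_cmult_right has_sum_dirichlet_conv p_has_sum one_has_sum x)
    moreover have "zeta_real (x + w) * (zeta_real (x + w) * R x) = c * (zeta_real (x + 2 * w - 1) * zeta_real x)"
      using zeta_real_pos[of "x + w"] x w by (simp add: R_def c_def power2_eq_square)
    ultimately have "((\<lambda>n. dirichlet_conv a (dirichlet_conv a f) n * real n powr - x + - c * (dirichlet_conv p (\<lambda>_. 1) n * real n powr - x))
      has_sum (c * (zeta_real (x + 2 * w - 1) * zeta_real x) + - c * (zeta_real (x + 2 * w - 1) * zeta_real x))) {0<..}"
      by (intro has_sum_add) auto
    then show "((\<lambda>n. (dirichlet_conv a (dirichlet_conv a f) n - c * dirichlet_conv p (\<lambda>_. 1) n) * real n powr - x) has_sum 0) {0<..}"
      by (simp add: algebra_simps)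
  qed
  moreover have "dirichlet_conv a (dirichlet_conv a B) n = c * dirichlet_conv p (\<lambda>_. 1) n" if "n > 0" for n
    using dirichlet_conv_primitive_sum[OF w that] zeta_real_pos[of "2 * w"] w
    by (simp add: a_def B_def p_def c_def field_simps)
  ultimately have eq: "dirichlet_conv a (dirichlet_conv a f) n = dirichlet_conv a (dirichlet_conv a B) n" if "n > 0" for n
    using that by simp
  have a1: "a 1 = 1" by (simp add: a_def)
  \<comment> \<open>As \<open>a 1 = 1\<close>, convolution with \<open>a\<close> can be cancelled,
    and this is done twice because zeta at \<open>s + 2m\<close> occurs squared.\<close>
  have "f k = B k"
  proof (rule dirichlet_conv_left_cancel[where a = a and b = f and c = B])
    show "dirichlet_conv a f n = dirichlet_conv a B n" if "n > 0" for n
      by (rule dirichlet_conv_left_cancel[where a = a and b = "dirichlet_conv a f" and c = "dirichlet_conv a B"])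
        (use eq a1 that in auto)
  qed (use a1 assms(3) in auto)
  then show ?thesis by (simp add: B_def w_def)
qed

section \<open>The moment asymptotics\<close>

lemma abs_power_diff_le:
  fixes a b M :: real
  assumes "\<bar>a\<bar> \<le> M" and "\<bar>b\<bar> \<le> M"
  shows "\<bar>a ^ Suc n - b ^ Suc n\<bar> \<le> real (Suc n) * \<bar>a - b\<bar> * M ^ n"
proof (induction n)
  case 0
  then show ?case by simp
next
  case (Suc n)
  have M: "0 \<le> M" using assms by linarith
  have "a ^ Suc (Suc n) - b ^ Suc (Suc n) = a * (a ^ Suc n - b ^ Suc n) + (a - b) * b ^ Suc n"
    by (simp add: algebra_simps)
  then have "\<bar>a ^ Suc (Suc n) - b ^ Suc (Suc n)\<bar> \<le> \<bar>a\<bar> * \<bar>a ^ Suc n - b ^ Suc n\<bar> + \<bar>a - b\<bar> * \<bar>b\<bar> ^ Suc n"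
    by (metis abs_mult abs_triangle_ineq power_abs)
  also have "\<dots> \<le> M * (real (Suc n) * \<bar>a - b\<bar> * M ^ n) + \<bar>a - b\<bar> * M ^ Suc n"
    using Suc.IH assms M by (intro add_mono mult_mono power_mono mult_nonneg_nonneg) auto
  also have "\<dots> = real (Suc (Suc n)) * \<bar>a - b\<bar> * M ^ Suc n" by (simp add: algebra_simps)
  finally show ?case .
qed

section \<open>Small pairs and minimal pairs\<close>

lemma pair_size_ge_1: "p \<in> approx_pairs h k \<Longrightarrow> 1 \<le> pair_size p"
proof -
  assume "p \<in> approx_pairs h k"
  then have "1 \<le> real (fst p)" "1 \<le> \<bar>real_of_int (snd p)\<bar>" by (auto simp: approx_pairs_def)
  then show ?thesis unfolding pair_size_def using mult_mono[of 1 "real (fst p)" 1 "\<bar>real_of_int (snd p)\<bar>"] by simp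
qed

lemma dedekind_sum_near_primitive_pair:
  assumes "coprime h k" and "k > 0" and "(d, r) \<in> primitive_pairs h k" and "pair_size (d, r) \<le> real k"
  shows "\<bar>dedekind_sum (int h) k - real k / (12 * (real d * of_int r))\<bar> \<le> pair_size (d, r)"
proof -
  define c where "c = (int h * int d - r) div int k"
  have p: "d > 0" "r \<noteq> 0" "int k dvd int h * int d - r" "coprime c (int d)"
    using assms(3) by (auto simp: primitive_pairs_def approx_pairs_def c_def)
  have "int k * c = int h * int d - r" using p(3) by (simp add: c_def)
  moreover have "real_of_int (int d * \<bar>r\<bar>) \<le> real_of_int (int k)" using assms(4) by (simp add: pair_size_def)
  ultimately show ?thesis
    unfolding pair_size_def fst_conv snd_conv
    using assms p by (intro dedekind_sum_near_fraction[where c = c]) (auto simp only: of_int_le_iff coprime_int_iff)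
qed

text \<open>The determinant of the two fractions satisfies
  \<open>k (c' d - c d') = r d' - r' d\<close>, whose absolute value is at most
  \<open>2 N N' <= N^2 + N'^2 < k\<close>. So it vanishes, and equal fractions in lowest terms have
  the same denominator. The threshold \<open>2 n^2 < k\<close> originates here.\<close>

lemma small_primitive_pair_unique:
  assumes "k > 0" and "p \<in> primitive_pairs h k" and "p' \<in> primitive_pairs h k"
    and "2 * (pair_size p)^2 < real k" and "2 * (pair_size p')^2 < real k"
  shows "p = p'"
proof -
  obtain d r d' r' where pp: "p = (d, r)" "p' = (d', r')" by (cases p; cases p')
  define c where "c = (int h * int d - r) div int k"
  define c' where "c' = (int h * int d' - r') div int k"
  have d: "d > 0" "r \<noteq> 0" "int k * c = int h * int d - r" "coprime c (int d)"
    using assms(2) by (auto simp: pp primitive_pairs_def approx_pairs_def c_def)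
  have d': "d' > 0" "r' \<noteq> 0" "int k * c' = int h * int d' - r'" "coprime c' (int d')"
    using assms(3) by (auto simp: pp primitive_pairs_def approx_pairs_def c'_def)
  define N where "N = int d * \<bar>r\<bar>"
  define N' where "N' = int d' * \<bar>r'\<bar>"
  have "real_of_int (2 * N^2) < real_of_int (int k)" "real_of_int (2 * N'^2) < real_of_int (int k)"
    using assms(4,5) by (simp_all add: pp pair_size_def N_def N'_def)
  then have N: "2 * N^2 < int k" "2 * N'^2 < int k" by (simp_all only: of_int_less_iff)
  have le: "int d \<le> N" "\<bar>r\<bar> \<le> N" "int d' \<le> N'" "\<bar>r'\<bar> \<le> N'"
    using d d' by (simp_all add: N_def N'_def mult_le_cancel_left1 mult_le_cancel_right1)
  have "int k * \<bar>c' * int d - c * int d'\<bar> = \<bar>r * int d' - r' * int d\<bar>"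
  proof -
    have "int k * (c' * int d - c * int d') = (int k * c') * int d - (int k * c) * int d'" by (simp add: algebra_simps)
    also have "\<dots> = r * int d' - r' * int d" unfolding d d' by (simp add: algebra_simps)
    finally show ?thesis by (metis abs_mult abs_of_nat)
  qed
  also have "\<dots> \<le> \<bar>r\<bar> * int d' + \<bar>r'\<bar> * int d"
    by (rule order.trans[OF abs_triangle_ineq4]) (simp add: abs_mult)
  also have "\<dots> \<le> N * N' + N' * N" using le by (intro add_mono mult_mono) auto
  also have "\<dots> \<le> N^2 + N'^2" using zero_le_power2[of "N - N'"] by (simp add: power2_diff algebra_simps)
  also have "\<dots> < int k" using N by simp
  finally have "int k * \<bar>c' * int d - c * int d'\<bar> < int k * 1" by simp
  then have "\<bar>c' * int d - c * int d'\<bar> < 1" using assms(1) by (simp only: mult_less_cancel_left_pos of_nat_0_less_iff)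
  then have e: "c' * int d = c * int d'" by simp
  have "int d dvd c * int d'" by (metis e dvd_triv_right)
  then have "int d dvd int d'" using d(4) by (metis coprime_commute coprime_dvd_mult_right_iff)
  moreover have "int d' dvd c' * int d" by (metis e dvd_triv_right)
  then have "int d' dvd int d" using d'(4) by (metis coprime_commute coprime_dvd_mult_right_iff)
  ultimately have dd: "d = d'" by (simp add: dvd_antisym)
  then have "c = c'" using e d(1) by simp
  then have "r = r'" using d(3) d'(3) dd by simp
  then show ?thesis using dd pp by simp
qed

text \<open>A minimal pair is automatically primitive: removing a common factor \<open>g\<close> of
  \<open>c\<close> and \<open>d\<close> divides the size by \<open>g^2\<close>.\<close>

lemma minimal_pair_exists:
  assumes "k > 0" and "h \<in> {1..k}"
  obtains p where "p \<in> primitive_pairs h k" and "pair_size p \<le> real k"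
    and "\<And>p'. p' \<in> approx_pairs h k \<Longrightarrow> pair_size p \<le> pair_size p'"
proof -
  define size where "size = (\<lambda>p :: nat \<times> int. fst p * nat \<bar>snd p\<bar>)"
  have size: "pair_size p = real (size p)" for p by (simp add: pair_size_def size_def)
  \<comment> \<open>The approximation \<open>0 / 1\<close>, with \<open>r = h\<close>; it bounds the
    minimum by \<open>h\<close>, hence by \<open>k\<close>.\<close>
  have h: "(1, int h) \<in> approx_pairs h k" using assms by (simp add: approx_pairs_def)
  define p where "p = arg_min size (\<lambda>p. p \<in> approx_pairs h k)"
  have p: "p \<in> approx_pairs h k" unfolding p_def by (rule arg_min_natI[where P = "\<lambda>p. p \<in> approx_pairs h k", OF h])
  have min: "size p \<le> size p'" if "p' \<in> approx_pairs h k" for p'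
    unfolding p_def by (rule arg_min_nat_le[where P = "\<lambda>p. p \<in> approx_pairs h k", OF that])
  obtain d r where dr: "p = (d, r)" by (cases p)
  define c where "c = (int h * int d - r) div int k"
  have d: "d > 0" "r \<noteq> 0" "int k * c = int h * int d - r"
    using p by (auto simp: dr approx_pairs_def c_def)
  have "coprime c (int d)"
  proof (rule coprimeI)
    fix g assume "g dvd c" "g dvd int d"
    then obtain c' d' where g: "c = \<bar>g\<bar> * c'" "int d = \<bar>g\<bar> * d'" by (metis abs_dvd_iff dvdE)
    have g0: "\<bar>g\<bar> > 0" using d(1) g(2) by (cases "g = 0") auto
    have d'0: "d' > 0" using g(2) d(1) g0 by (metis of_nat_0_less_iff zero_less_mult_pos)
    define r' where "r' = int h * d' - int k * c'"
    have r: "r = \<bar>g\<bar> * r'" using d(3) by (simp add: g r'_def algebra_simps)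
    have "(nat d', r') \<in> approx_pairs h k"
      using d'0 d(2) r by (auto simp: approx_pairs_def r'_def)
    from min[OF this] have "d * nat \<bar>r\<bar> \<le> nat d' * nat \<bar>r'\<bar>" by (simp add: size_def dr)
    then have "int (d * nat \<bar>r\<bar>) \<le> int (nat d' * nat \<bar>r'\<bar>)" by (simp only: of_nat_le_iff)
    then have "int d * \<bar>r\<bar> \<le> d' * \<bar>r'\<bar>" using d'0 by simp
    then have "\<bar>g\<bar> * \<bar>g\<bar> * (d' * \<bar>r'\<bar>) \<le> 1 * (d' * \<bar>r'\<bar>)"
      unfolding g(2) by (subst (asm) r) (simp add: abs_mult mult_ac)
    moreover have "d' * \<bar>r'\<bar> > 0" using d'0 d(2) r by auto
    ultimately have "\<bar>g\<bar> * \<bar>g\<bar> \<le> 1" by (simp only: mult_le_cancel_right_pos)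
    moreover have "\<bar>g\<bar> * 1 \<le> \<bar>g\<bar> * \<bar>g\<bar>" using g0 by (intro mult_left_mono) auto
    ultimately have "\<bar>g\<bar> = 1" using g0 by linarith
    then show "is_unit g" by simp
  qed
  then have "p \<in> primitive_pairs h k" using p by (simp add: primitive_pairs_def dr c_def)
  moreover have "size p \<le> k" using min[OF h] assms by (simp add: size_def)
  ultimately show thesis using that[of p] min by (simp add: size)
qed

lemma abs_dedekind_sum_le_minimal_pair:
  assumes "k \<ge> 3" and "h \<in> {1..k}" and "coprime h k" and p: "p \<in> primitive_pairs h k" "pair_size p \<le> real k"
    and min: "\<And>p'. p' \<in> approx_pairs h k \<Longrightarrow> pair_size p \<le> pair_size p'"
  shows "\<bar>dedekind_sum (int h) k\<bar> \<le> 5 * ln (real k) * (real k / pair_size p)"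
proof -
  have n1: "1 \<le> pair_size p" using p(1) by (intro pair_size_ge_1[of _ h k]) (auto simp: primitive_pairs_def)
  have "\<bar>dedekind_sum (int h) k\<bar> \<le> real k / pair_size p * (1 + log 2 (real k * real h))"
  \<comment> \<open>Euclid's algorithm starts with the remainders \<open>k\<close>, \<open>h\<close>
    and the denominators \<open>q' = 0\<close>, \<open>q = 1\<close>.\<close>
  proof (rule dedekind_sum_euclid_bound[where h = "int h" and e = 1 and q = 1 and q' = 0])
    fix q y assume q: "0 < q" "y \<noteq> 0" "int k dvd int q * int h - y"
    then have "(q, y) \<in> approx_pairs h k" by (simp add: approx_pairs_def mult.commute)
    from min[OF this] show "pair_size p \<le> real q * \<bar>real_of_int y\<bar>" by (simp add: pair_size_def)
  qed (use assms n1 in \<open>auto simp: coprime_commute\<close>)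
  also have "\<dots> \<le> real k / pair_size p * (5 * ln (real k))"
  proof (rule mult_left_mono)
    \<comment> \<open>The bound \<open>k >= 3 >= exp 1\<close> lets the summand 1 be absorbed; with
      \<open>ln 2 >= 1 / 2\<close> the factor becomes \<open>1 + 4 ln k <= 5 ln k\<close>.\<close>
    have l3: "1 \<le> ln (real k)"
    proof -
      have "exp 1 \<le> real k" using exp_le assms(1) by linarith
      then show ?thesis using assms(1) by (simp add: ln_ge_iff)
    qed
    have l2: "1 / 2 \<le> ln (2::real)" using ln2_ge_two_thirds by simp
    have "ln (real k * real h) \<le> 2 * ln (real k)"
      using assms by (simp add: ln_mult)
    then have "log 2 (real k * real h) \<le> 2 * ln (real k) / ln 2" by (simp add: log_def divide_right_mono)
    also have "\<dots> \<le> 2 * ln (real k) / (1 / 2)" using l2 l3 by (intro divide_left_mono) auto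
    finally show "1 + log 2 (real k * real h) \<le> 5 * ln (real k)" using l3 by simp
  qed (use n1 in auto)
  finally show ?thesis by (simp add: mult_ac)
qed

text \<open>The factor \<open>n powr - (3 / 2)\<close> is saved for the sum over pairs. The
  remaining exponent \<open>3 / 2 - 2 * m\<close> is negative, so \<open>n^2 >= k / 2\<close> can be
  inserted there.\<close>

lemma powr_neg_le_of_large:
  fixes n k :: real
  assumes "m > 0" and "k > 0" and "n \<ge> 1" and "k \<le> 2 * n^2"
  shows "k ^ (2 * m) * n powr - (2 * real m) \<le> 2 ^ m * k powr (real m + 3 / 4) * n powr - (3 / 2)"
proof -
  have m1: "real m \<ge> 1" using assms(1) by simp
  have "n powr (3 / 2 - 2 * real m) = (n powr 2) powr (3 / 4 - real m)" by (simp add: powr_powr algebra_simps)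
  also have "\<dots> \<le> (k / 2) powr (3 / 4 - real m)"
    using assms m1 by (intro powr_mono2') (auto simp: powr_numeral)
  also have "\<dots> = k powr (3 / 4 - real m) * 2 powr (real m - 3 / 4)"
    using assms powr_minus_divide[of 2 "3 / 4 - real m"] by (simp add: powr_divide)
  also have "\<dots> \<le> k powr (3 / 4 - real m) * 2 powr real m"
    by (intro mult_left_mono powr_mono) auto
  finally have b: "n powr (3 / 2 - 2 * real m) \<le> 2 ^ m * k powr (3 / 4 - real m)" by (simp add: powr_realpow mult.commute)
  have "k ^ (2 * m) * n powr - (2 * real m) = k ^ (2 * m) * n powr (3 / 2 - 2 * real m) * n powr - (3 / 2)"
    by (simp add: powr_add[symmetric])
  also have "\<dots> \<le> k ^ (2 * m) * (2 ^ m * k powr (3 / 4 - real m)) * n powr - (3 / 2)"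
    using b assms by (intro mult_right_mono mult_left_mono) auto
  also have "k ^ (2 * m) * (2 ^ m * k powr (3 / 4 - real m)) = 2 ^ m * k powr (real m + 3 / 4)"
  proof -
    have "k ^ (2 * m) = k powr (2 * real m)" using assms powr_realpow[of k "2 * m"] by simp
    then show ?thesis by (simp add: powr_add[symmetric])
  qed
  finally show ?thesis .
qed

text \<open>Here \<open>s\<close> differs by at most \<open>n\<close> from a main term of absolute
  value \<open>k / (12 n)\<close>, and \<open>n <= k / n\<close>; so the powers differ by a multiple
  of \<open>k^(2m-1) n^(2-2m)\<close>.\<close>

lemma dedekind_power_error_small_pair:
  assumes "m > 0" and "k > 0" and "coprime h k" and p: "p \<in> primitive_pairs h k"
    and small: "2 * (pair_size p)^2 < real k"
  shows "\<bar>dedekind_sum (int h) k ^ (2 * m) - (real k / 12) ^ (2 * m) * pair_size p powr - (2 * real m)\<bar>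
    \<le> real (2 * m) * 2 ^ (2 * m) * (real k powr (real m + 3 / 4) + real k powr (2 * real m - 1)) * pair_size p powr - (3 / 2)"
proof -
  define n where "n = pair_size p"
  define s where "s = dedekind_sum (int h) k"
  define K where "K = real k"
  have K1: "K \<ge> 1" using assms(2) by (simp add: K_def)
  have n1: "1 \<le> n" unfolding n_def using p by (intro pair_size_ge_1[of _ h k]) (auto simp: primitive_pairs_def)
  have nk: "n^2 \<le> K" using small zero_le_power2[of n] unfolding n_def K_def by linarith
  have "n \<le> n^2" using n1 by (simp add: power2_eq_square)
  then have nK: "n \<le> K" using nk by linarith
  obtain d r where dr: "p = (d, r)" by (cases p)
  define x where "x = K / (12 * (real d * of_int r))"
  have sx: "\<bar>s - x\<bar> \<le> n"
    unfolding s_def x_def n_def dr K_def using assms nK by (intro dedekind_sum_near_primitive_pair) (auto simp: dr n_def K_def)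
  have x: "\<bar>x\<bar> = K / 12 / n" unfolding x_def n_def dr using K1 by (simp add: pair_size_def abs_mult)
  have xpow: "x ^ (2 * m) = (K / 12) ^ (2 * m) * n powr - (2 * real m)"
  proof -
    have "x ^ (2 * m) = \<bar>x\<bar> ^ (2 * m)" by (simp add: power_even_abs)
    also have "\<dots> = (K / 12) ^ (2 * m) / n ^ (2 * m)" by (simp only: x power_divide)
    also have "n ^ (2 * m) = n powr (2 * real m)" using n1 powr_realpow[of n "2 * m"] by simp
    finally show ?thesis by (simp add: powr_minus_divide)
  qed
  define M where "M = 2 * K / n"
  have "n \<le> K / n" using nk n1 by (simp add: field_simps power2_eq_square)
  moreover have "\<bar>x\<bar> \<le> K / n" unfolding x using n1 K1 by (simp add: field_simps)
  ultimately have bM: "\<bar>s\<bar> \<le> M" "\<bar>x\<bar> \<le> M" using sx unfolding M_def by linarith+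
  obtain j where j: "2 * m = Suc j" using assms(1) by (cases "2 * m") auto
  have "\<bar>s ^ (2 * m) - x ^ (2 * m)\<bar> \<le> real (2 * m) * \<bar>s - x\<bar> * M ^ j"
    unfolding j by (rule abs_power_diff_le[OF bM])
  also have "\<dots> \<le> real (2 * m) * n * M ^ j"
    using sx bM by (intro mult_right_mono mult_left_mono) auto
  also have "M ^ j = 2 ^ j * (K ^ j * n powr - real j)"
    using n1 by (simp add: M_def power_divide power_mult_distrib powr_minus_divide powr_realpow)
  also have "real (2 * m) * n * (2 ^ j * (K ^ j * n powr - real j)) = real (2 * m) * 2 ^ j * (K ^ j * n powr (1 - real j))"
    using n1 by (simp add: powr_diff powr_minus_divide)
  also have "\<dots> \<le> real (2 * m) * 2 ^ (2 * m) * (K ^ j * n powr (1 - real j))"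
    using K1 j by (intro mult_right_mono mult_left_mono) auto
  also have "K ^ j * n powr (1 - real j) \<le> (K powr (real m + 3 / 4) + K powr (2 * real m - 1)) * n powr - (3 / 2)"
  proof -
    have rj: "real j = 2 * real m - 1" using j by linarith
    have Kj: "K ^ j = K powr (2 * real m - 1)" using K1 powr_realpow[of K j] rj by simp
    have nn: "n powr (1 - real j) = n powr (7 / 2 - 2 * real m) * n powr - (3 / 2)"
      by (simp add: powr_add[symmetric] rj)
    have "K ^ j * n powr (7 / 2 - 2 * real m) \<le> K powr (real m + 3 / 4) + K powr (2 * real m - 1)"
    \<comment> \<open>After \<open>n powr - (3 / 2)\<close> is split off, the exponent
      \<open>7 / 2 - 2 * m\<close> is positive only for \<open>m = 1\<close>. There
      \<open>n^2 <= K\<close> turns \<open>n powr (3 / 2)\<close> into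
      \<open>K powr (3 / 4)\<close>; otherwise the power is at most 1.\<close>
    proof (cases "m = 1")
      case True
      have "n powr (3 / 2) = (n powr 2) powr (3 / 4)" by (simp add: powr_powr)
      also have "\<dots> \<le> K powr (3 / 4)" using nk n1 by (intro powr_mono2) (auto simp: powr_numeral)
      finally have "K powr 1 * n powr (3 / 2) \<le> K powr 1 * K powr (3 / 4)" by (intro mult_left_mono) auto
      also have "\<dots> = K powr (real m + 3 / 4)" unfolding powr_add[symmetric] True by simp
      finally show ?thesis unfolding Kj using True by simp
    next
      case False
      then have "m \<ge> 2" using assms(1) by simp
      then have "n powr (7 / 2 - 2 * real m) \<le> n powr 0" using n1 by (intro powr_mono) auto
      then have "K ^ j * n powr (7 / 2 - 2 * real m) \<le> K ^ j * 1" using n1 K1 by (intro mult_left_mono) auto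
      then show ?thesis unfolding Kj by (simp add: add_increasing)
    qed
    then show ?thesis unfolding nn by (simp add: mult.assoc[symmetric] mult_right_mono)
  qed
  finally show ?thesis unfolding xpow s_def n_def K_def by (simp add: mult.assoc mult_left_mono)
qed

lemma dedekind_power_error:
  assumes "m > 0" and "k \<ge> 3" and "h \<in> {1..k}" and "coprime h k"
  shows "\<bar>dedekind_sum (int h) k ^ (2 * m) - (real k / 12) ^ (2 * m) * primitive_sum (2 * real m) h k\<bar>
    \<le> (real (2 * m) * 2 ^ (2 * m) + 2 ^ m + 5 ^ (2 * m) * 2 ^ m)
      * (real k powr (real m + 3 / 4) * ln (real k) ^ (2 * m) + real k powr (2 * real m - 1))
      * primitive_sum (3 / 2) h k"
proof -
  define P where "P = primitive_pairs h k"
  define K where "K = real k"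
  define s where "s = dedekind_sum (int h) k"
  define q where "q = (\<lambda>p. (K / 12) ^ (2 * m) * pair_size p powr - (2 * real m))"
  define t where "t = (\<lambda>p. pair_size p powr - (3 / 2))"
  define Q where "Q = (K / 12) ^ (2 * m) * primitive_sum (2 * real m) h k"
  define T where "T = primitive_sum (3 / 2) h k"
  define X where "X = K powr (real m + 3 / 4)"
  define L where "L = ln K"
  define Y where "Y = K powr (2 * real m - 1)"
  have k0: "k > 0" using assms(2) by simp
  have K: "K \<ge> 3" using assms(2) by (simp add: K_def)
  have X0: "X \<ge> 0" and Y0: "Y \<ge> 0" by (simp_all add: X_def Y_def)
  have L1: "1 \<le> L"
  proof -
    have "exp 1 \<le> K" using exp_le K by linarith
    then show ?thesis using K by (simp add: L_def ln_ge_iff)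
  qed
  then have XL: "X \<le> X * L ^ (2 * m)" using X0 by (simp add: mult_left_le one_le_power mult_le_cancel_left1)
  have q_sum: "(q has_sum Q) P"
    unfolding q_def Q_def P_def using assms k0 by (intro has_sum_cmult_right has_sum_primitive_sum) auto
  have t_sum: "(t has_sum T) P"
    unfolding t_def T_def P_def using assms k0 by (intro has_sum_primitive_sum) auto
  have t0: "t p \<ge> 0" for p by (simp add: t_def)
  have q0: "q p \<ge> 0" for p using K by (simp add: q_def)
  have large_pow: "K ^ (2 * m) * pair_size p powr - (2 * real m) \<le> 2 ^ m * X * t p"
    if "p \<in> P" "\<not> 2 * (pair_size p)^2 < K" for p
  proof -
    have "1 \<le> pair_size p" using that(1) by (intro pair_size_ge_1[of _ h k]) (auto simp: P_def primitive_pairs_def)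
    then show ?thesis unfolding X_def t_def using assms K that(2) by (intro powr_neg_le_of_large) auto
  qed
  have q_large: "q p \<le> 2 ^ m * X * t p" if "p \<in> P" "\<not> 2 * (pair_size p)^2 < K" for p
  proof -
    have "(K / 12) ^ (2 * m) \<le> K ^ (2 * m)" using K by (intro power_mono) auto
    then have "q p \<le> K ^ (2 * m) * pair_size p powr - (2 * real m)"
      unfolding q_def by (intro mult_right_mono) auto
    then show ?thesis using large_pow[OF that] by linarith
  qed
  define c1 where "c1 = real (2 * m) * 2 ^ (2 * m)"
  define c2 :: real where "c2 = 2 ^ m"
  define c3 :: real where "c3 = 5 ^ (2 * m) * 2 ^ m"
  have c0: "c1 \<ge> 0" "c2 \<ge> 0" "c3 \<ge> 0" by (simp_all add: c1_def c2_def c3_def)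
  have nn: "0 \<le> c2 * (X * L ^ (2 * m))" "0 \<le> c1 * (X * L ^ (2 * m))" "0 \<le> c3 * (X * L ^ (2 * m))"
     "0 \<le> c1 * Y" "0 \<le> c2 * Y" "0 \<le> c3 * Y"
    using c0 X0 Y0 L1 by simp_all
  have "\<bar>s ^ (2 * m) - Q\<bar> \<le> (c1 + c2 + c3) * (X * L ^ (2 * m) + Y) * T"
  proof (cases "\<exists>p\<in>P. 2 * (pair_size p)^2 < K")
    case True
    then obtain p0 where p0: "p0 \<in> P" "2 * (pair_size p0)^2 < K" by blast
    have ins: "insert p0 (P - {p0}) = P" using p0 by auto
    \<comment> \<open>By uniqueness \<open>p0\<close> is the only small pair:
      \<open>s ^ (2 * m)\<close> is compared with \<open>q p0\<close> alone, and
      \<open>q_large\<close> makes the whole tail an error term.\<close>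
    have rest: "\<not> 2 * (pair_size p)^2 < K" if "p \<in> P - {p0}" for p
      using small_primitive_pair_unique[OF k0, of p h p0] that p0 by (auto simp: P_def K_def)
    obtain Q' where Q': "(q has_sum Q') (P - {p0})"
      using summable_on_subset[OF has_sum_imp_summable[OF q_sum], of "P - {p0}"] by (auto simp: summable_on_def)
    obtain T' where T': "(t has_sum T') (P - {p0})"
      using summable_on_subset[OF has_sum_imp_summable[OF t_sum], of "P - {p0}"] by (auto simp: summable_on_def)
    have "(q has_sum (q p0 + Q')) (insert p0 (P - {p0}))" by (rule has_sum_insert[OF _ Q']) simp
    then have Q: "Q = q p0 + Q'" using q_sum unfolding ins by (metis has_sum_unique)
    have "(t has_sum (t p0 + T')) (insert p0 (P - {p0}))" by (rule has_sum_insert[OF _ T']) simp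
    then have T: "T = t p0 + T'" using t_sum unfolding ins by (metis has_sum_unique)
    have Q'0: "0 \<le> Q'" using Q' by (rule has_sum_nonneg) (simp add: q0)
    have T'0: "0 \<le> T'" using T' by (rule has_sum_nonneg) (simp add: t0)
    have "Q' \<le> c2 * X * T'"
      unfolding c2_def by (rule has_sum_mono[OF Q' has_sum_cmult_right[OF T']]) (use q_large rest in auto)
    also have "\<dots> \<le> (c1 + c2 + c3) * (X * L ^ (2 * m) + Y) * T'"
    proof (intro mult_right_mono T'0)
      have "c2 * X \<le> c2 * (X * L ^ (2 * m))" using XL c0 by (intro mult_left_mono) auto
      then show "c2 * X \<le> (c1 + c2 + c3) * (X * L ^ (2 * m) + Y)" using nn unfolding distrib_left distrib_right by linarith
    qed
    finally have 1: "Q' \<le> (c1 + c2 + c3) * (X * L ^ (2 * m) + Y) * T'" .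
    have "\<bar>s ^ (2 * m) - q p0\<bar> \<le> c1 * (X + Y) * t p0"
      unfolding s_def q_def c1_def X_def Y_def t_def K_def
      using assms k0 p0 by (intro dedekind_power_error_small_pair) (auto simp: P_def K_def)
    also have "\<dots> \<le> (c1 + c2 + c3) * (X * L ^ (2 * m) + Y) * t p0"
    proof (intro mult_right_mono t0)
      have "c1 * X \<le> c1 * (X * L ^ (2 * m))" using XL c0 by (intro mult_left_mono) auto
      then show "c1 * (X + Y) \<le> (c1 + c2 + c3) * (X * L ^ (2 * m) + Y)" using nn unfolding distrib_left distrib_right by linarith
    qed
    finally have 2: "\<bar>s ^ (2 * m) - q p0\<bar> \<le> (c1 + c2 + c3) * (X * L ^ (2 * m) + Y) * t p0" .
    show ?thesis unfolding Q T distrib_left[of _ "t p0"] using 1 2 Q'0 by linarith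
  next
    case False
    \<comment> \<open>No term of the sum approximates \<open>s ^ (2 * m)\<close>, so it and
      \<open>Q\<close> are bounded separately. The minimal pair is itself large, which makes the
      Euclidean bound for \<open>s\<close> sufficient.\<close>
    obtain p1 where p1: "p1 \<in> primitive_pairs h k" "pair_size p1 \<le> real k"
      "\<And>p'. p' \<in> approx_pairs h k \<Longrightarrow> pair_size p1 \<le> pair_size p'"
      using minimal_pair_exists[OF k0 assms(3)] by blast
    define n where "n = pair_size p1"
    have n1: "1 \<le> n" unfolding n_def using p1(1) by (intro pair_size_ge_1[of _ h k]) (auto simp: primitive_pairs_def)
    have "\<bar>s\<bar> \<le> 5 * L * (K / n)"
      unfolding s_def L_def K_def n_def using assms p1 by (intro abs_dedekind_sum_le_minimal_pair) auto
    then have "\<bar>s\<bar> ^ (2 * m) \<le> (5 * L * (K / n)) ^ (2 * m)" by (intro power_mono) auto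
    also have "\<dots> = 5 ^ (2 * m) * L ^ (2 * m) * (K ^ (2 * m) * n powr - (2 * real m))"
    proof -
      have "n ^ (2 * m) = n powr (2 * real m)" using n1 powr_realpow[of n "2 * m"] by simp
      then show ?thesis by (simp add: power_mult_distrib power_divide powr_minus_divide)
    qed
    also have "\<dots> \<le> 5 ^ (2 * m) * L ^ (2 * m) * (2 ^ m * X * t p1)"
      using large_pow[of p1] False p1(1) L1 unfolding n_def P_def by (intro mult_left_mono) auto
    also have "\<dots> = c3 * (X * L ^ (2 * m)) * t p1" by (simp add: c3_def)
    also have "\<dots> \<le> c3 * (X * L ^ (2 * m)) * T"
    proof (intro mult_left_mono nn)
      have "sum t {p1} \<le> T" by (rule finite_sum_le_has_sum[OF t_sum]) (use p1 t0 in \<open>auto simp: P_def\<close>)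
      then show "t p1 \<le> T" by simp
    qed
    finally have 1: "s ^ (2 * m) \<le> c3 * (X * L ^ (2 * m)) * T" by (simp add: power_even_abs)
    have T0: "0 \<le> T" using t_sum by (rule has_sum_nonneg) (simp add: t0)
    have "Q \<le> c2 * X * T"
      unfolding c2_def by (rule has_sum_mono[OF q_sum has_sum_cmult_right[OF t_sum]]) (use q_large False in auto)
    also have "\<dots> \<le> c2 * (X * L ^ (2 * m)) * T" using XL c0 T0 by (intro mult_right_mono mult_left_mono) auto
    finally have 2: "Q \<le> c2 * (X * L ^ (2 * m)) * T" .
    have "0 \<le> Q" using q_sum by (rule has_sum_nonneg) (simp add: q0)
    moreover have "0 \<le> s ^ (2 * m)" by simp
    ultimately have "\<bar>s ^ (2 * m) - Q\<bar> \<le> c3 * (X * L ^ (2 * m)) * T + c2 * (X * L ^ (2 * m)) * T"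
      using 1 2 unfolding abs_le_iff by linarith
    also have "\<dots> = (c3 * (X * L ^ (2 * m)) + c2 * (X * L ^ (2 * m))) * T" by (simp add: distrib_right)
    also have "\<dots> \<le> (c1 + c2 + c3) * (X * L ^ (2 * m) + Y) * T"
      using nn unfolding distrib_left distrib_right[of _ _ "X * L ^ (2 * m)"] distrib_right[of _ _ Y]
      by (intro mult_right_mono T0) linarith
    finally show ?thesis .
  qed
  then show ?thesis by (simp add: s_def Q_def T_def X_def Y_def L_def K_def c1_def c2_def c3_def)
qed

lemma error_term_bigo:
  assumes "m > 0"
  shows "(\<lambda>k::nat. real k powr (real m + 3 / 4) * ln (real k) ^ (2 * m) + real k powr (2 * real m - 1))
    \<in> O(\<lambda>k. (real k powr (9 / 5) + real k powr (2 * real m - 1 + 1 / (real m + 1))) * ln (real k) ^ 3)"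
proof -
  have ln1: "1 \<le> ln (real k)" if "k \<ge> 3" for k :: nat
  proof -
    have "exp 1 \<le> real k" using exp_le that by linarith
    then show ?thesis using that by (simp add: ln_ge_iff)
  qed
  \<comment> \<open>The gap between the admissible exponent and \<open>m + 3 / 4\<close>:
    \<open>1 / 20\<close> for \<open>m = 1\<close>, and \<open>m - 7 / 4 + 1 / (m + 1)\<close>
    otherwise. Bounding each of the \<open>2 * m\<close> logarithms by \<open>K powr a / a\<close>
    uses up exactly this gap.\<close>
  define \<delta> where "\<delta> = (if m = 1 then 9 / 5 else 2 * real m - 1 + 1 / (real m + 1)) - (real m + 3 / 4)"
  define a where "a = \<delta> / (2 * real m)"
  have "\<delta> > 0"
  proof (cases "m = 1")
    case False
    then have "real m \<ge> 2" using assms by linarith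
    then have "0 < (real m - 7 / 4) + 1 / (real m + 1)" by (intro add_pos_pos) auto
    also have "\<dots> = \<delta>" using False by (simp add: \<delta>_def)
    finally show ?thesis .
  qed (simp add: \<delta>_def)
  then have a: "a > 0" using assms by (simp add: a_def)
  define C where "C = (1 / a) ^ (2 * m)"
  have C0: "C > 0" using a by (simp add: C_def)
  have bound: "real k powr (real m + 3 / 4) * ln (real k) ^ (2 * m) + real k powr (2 * real m - 1)
    \<le> (C + 1) * ((real k powr (9 / 5) + real k powr (2 * real m - 1 + 1 / (real m + 1))) * ln (real k) ^ 3)"
    if k: "k \<ge> 3" for k :: nat
  proof -
    define K where "K = real k"
    have K: "K \<ge> 3" using k by (simp add: K_def)
    define R where "R = K powr (9 / 5) + K powr (2 * real m - 1 + 1 / (real m + 1))"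
    have R0: "R \<ge> 0" by (simp add: R_def)
    have "ln K ^ (2 * m) \<le> (K powr a / a) ^ (2 * m)"
      using K a by (intro power_mono ln_powr_bound) auto
    also have "\<dots> = C * K powr (a * (2 * real m))"
    proof -
      have "(K powr a) ^ (2 * m) = (K powr a) powr real (2 * m)" using K by (subst powr_realpow) auto
      also have "\<dots> = K powr (a * (2 * real m))" by (simp add: powr_powr)
      finally show ?thesis by (simp add: C_def power_divide)
    qed
    also have "a * (2 * real m) = \<delta>" using assms by (simp add: a_def)
    finally have "K powr (real m + 3 / 4) * ln K ^ (2 * m) \<le> K powr (real m + 3 / 4) * (C * K powr \<delta>)"
      by (intro mult_left_mono) auto
    also have "\<dots> = C * K powr (real m + 3 / 4 + \<delta>)" by (simp add: powr_add)
    also have "\<dots> \<le> C * R"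
      using C0 by (intro mult_left_mono) (auto simp: R_def \<delta>_def)
    finally have 1: "K powr (real m + 3 / 4) * ln K ^ (2 * m) \<le> C * R" .
    have "K powr (2 * real m - 1) \<le> K powr (2 * real m - 1 + 1 / (real m + 1))"
      using K by (intro powr_mono) auto
    then have 2: "K powr (2 * real m - 1) \<le> R" unfolding R_def using powr_ge_zero[of K "9 / 5"] by linarith
    have "(C + 1) * R \<le> (C + 1) * (R * ln K ^ 3)"
      using ln1[OF k] R0 C0 unfolding K_def[symmetric]
      by (intro mult_left_mono) (auto simp: mult_le_cancel_left1 one_le_power)
    then show ?thesis using 1 2 unfolding K_def[symmetric] R_def[symmetric] by (simp add: distrib_right)
  qed
  show ?thesis
  proof (rule bigoI[of _ "C + 1"], rule eventually_sequentiallyI[of 3])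
    fix k :: nat assume k: "k \<ge> 3"
    have "0 \<le> ln (real k)" using ln1[OF k] by simp
    then show "norm (real k powr (real m + 3 / 4) * ln (real k) ^ (2 * m) + real k powr (2 * real m - 1))
      \<le> (C + 1) * norm ((real k powr (9 / 5) + real k powr (2 * real m - 1 + 1 / (real m + 1))) * ln (real k) ^ 3)"
      using bound[OF k] by (simp add: abs_mult)
  qed
qed

theorem theorem2:
  fixes m :: nat and f :: "nat \<Rightarrow> real"
  assumes "m > 0"
    and "\<And>s :: complex. Re s > 1 \<Longrightarrow>
      (\<lambda>n. of_real (f (Suc n)) / of_nat (Suc n) powr s) sums
        (2 * (zeta (2 * of_nat m) ^ 2 * zeta (s + 4 * of_nat m - 1)
              / (zeta (4 * of_nat m) * zeta (s + 2 * of_nat m) ^ 2)) * zeta s)"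
  shows "(\<lambda>k::nat. (\<Sum>h | h \<in> {1..k} \<and> coprime h k. dedekind_sum (int h) k ^ (2 * m))
             - f k * (real k / 12) ^ (2 * m))
         \<in> O(\<lambda>k. (real k powr (9 / 5) + real k powr (2 * real m - 1 + 1 / (real m + 1)))
                  * ln (real k) ^ 3)"
proof -
  define c where "c = real (2 * m) * 2 ^ (2 * m) + 2 ^ m + 5 ^ (2 * m) * 2 ^ m"
  define E where "E = (\<lambda>k::nat. real k powr (real m + 3 / 4) * ln (real k) ^ (2 * m) + real k powr (2 * real m - 1))"
  have c0: "c \<ge> 0" by (simp add: c_def)
  have "norm ((\<Sum>h | h \<in> {1..k} \<and> coprime h k. dedekind_sum (int h) k ^ (2 * m)) - f k * (real k / 12) ^ (2 * m))
    \<le> c * (2 * (zeta_real (3 / 2))^2) * norm (E k)" if k: "k \<ge> 3" for k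
  proof -
    let ?H = "{h. h \<in> {1..k} \<and> coprime h k}"
    have k0: "k > 0" using k by simp
    have E0: "E k \<ge> 0" using k by (simp add: E_def)
    have fk: "f k = (\<Sum>h\<in>?H. primitive_sum (2 * real m) h k)"
      using assms k0 by (rule dirichlet_coeff_eq_primitive_sum)
    have "f k * (real k / 12) ^ (2 * m) = (\<Sum>h\<in>?H. (real k / 12) ^ (2 * m) * primitive_sum (2 * real m) h k)"
      unfolding fk sum_distrib_right by (simp only: mult.commute[of "(real k / 12) ^ (2 * m)"])
    then have "\<bar>(\<Sum>h\<in>?H. dedekind_sum (int h) k ^ (2 * m)) - f k * (real k / 12) ^ (2 * m)\<bar>
      = \<bar>\<Sum>h\<in>?H. dedekind_sum (int h) k ^ (2 * m) - (real k / 12) ^ (2 * m) * primitive_sum (2 * real m) h k\<bar>"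
      by (simp only: sum_subtractf)
    also have "\<dots> \<le> (\<Sum>h\<in>?H. \<bar>dedekind_sum (int h) k ^ (2 * m) - (real k / 12) ^ (2 * m) * primitive_sum (2 * real m) h k\<bar>)"
      by (rule sum_abs)
    \<comment> \<open>Each \<open>h\<close> is charged in proportion to its own pairs, so the total
      does not depend on how many \<open>h\<close> there are.\<close>
    also have "\<dots> \<le> (\<Sum>h\<in>?H. c * E k * primitive_sum (3 / 2) h k)"
      unfolding c_def E_def using assms(1) k by (intro sum_mono dedekind_power_error) auto
    also have "\<dots> = c * E k * (\<Sum>h\<in>?H. primitive_sum (3 / 2) h k)" by (simp only: sum_distrib_left)
    also have "\<dots> \<le> c * E k * (2 * (zeta_real (3 / 2))^2)"
      using c0 E0 k0 by (intro mult_left_mono sum_primitive_sum_le) auto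
    finally show ?thesis using E0 by (simp add: mult_ac)
  qed
  then have "(\<lambda>k. (\<Sum>h | h \<in> {1..k} \<and> coprime h k. dedekind_sum (int h) k ^ (2 * m)) - f k * (real k / 12) ^ (2 * m)) \<in> O(E)"
    by (intro bigoI[of _ "c * (2 * (zeta_real (3 / 2))^2)"] eventually_sequentiallyI[of 3])
  also have "E \<in> O(\<lambda>k. (real k powr (9 / 5) + real k powr (2 * real m - 1 + 1 / (real m + 1))) * ln (real k) ^ 3)"
    unfolding E_def by (rule error_term_bigo[OF assms(1)])
  finally show ?thesis .
qed

end
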